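(* For all $u,w\in\mathbb{Q}$ (with $u,w>1$) outside a proper algebraic curve in the $(u,w)$-plane, there are infinitely many hyperbolic triangles with all side lengths rational, two of whose sides have lengths $a=2\log u$ and $\log w$, and whose median to the side of length $a$ is rational.
   Context: Triangles are non-degenerate, bounded triangles in the hyperbolic plane (curvature $-1$). A length $\ell$ is rational if $e^\ell\in\mathbb{Q}$; the median to side $a$ is the geodesic segment from the opposite vertex to the midpoint of side $a$. *)

theory Defs
  imports Complex_Main
begin

text \<open>The hyperbolic plane (curvature -1), Poincare upper half-plane model.\<close>

definition hplane :: "complex set" where
  "hplane = {z. Im z > 0}"

definition hdist :: "complex \<Rightarrow> complex \<Rightarrow> real" where
  "hdist z w = arcosh (1 + (cmod (z - w))\<^sup>2 / (2 * Im z * Im w))"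

text \<open>Collinearity: one of the three points lies on the geodesic segment
  between the other two (metric betweenness; the plane is uniquely geodesic).\<close>
definition hcollinear :: "complex \<Rightarrow> complex \<Rightarrow> complex \<Rightarrow> bool" where
  "hcollinear A B C \<longleftrightarrow>
     hdist A B + hdist B C = hdist A C \<or>
     hdist B A + hdist A C = hdist B C \<or>
     hdist A C + hdist C B = hdist A B"

definition hyp_triangle :: "complex \<Rightarrow> complex \<Rightarrow> complex \<Rightarrow> bool" where
  "hyp_triangle A B C \<longleftrightarrow> A \<in> hplane \<and> B \<in> hplane \<and> C \<in> hplane \<and> \<not> hcollinear A B C"

definition hmidpoint :: "complex \<Rightarrow> complex \<Rightarrow> complex \<Rightarrow> bool" where
  "hmidpoint B C M \<longleftrightarrow> M \<in> hplane \<and> hdist B M = hdist B C / 2 \<and> hdist M C = hdist B C / 2"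

definition rational_length :: "real \<Rightarrow> bool" where
  "rational_length l \<longleftrightarrow> exp l \<in> \<rat>"

end

theory Submission
  imports Defs "HOL-Analysis.Analysis"
begin

text \<open>
  Write \<open>U = u + 1/u\<close>, \<open>W = w + 1/w\<close>, \<open>v = e\<^sup>c\<close> for the third side \<open>c\<close> and \<open>t = e\<^sup>m\<close> for the median
  \<open>m\<close>. The median formula becomes the genus one curve \<open>W + v + 1/v = U (t + 1/t)\<close>, on which the
  degenerate triangle gives the rational point \<open>(v, t) = (u\<^sup>2w, uw)\<close>. The Jacobi curve
  \<open>c\<^sup>2 = 1 - b s\<^sup>2\<close>, \<open>d\<^sup>2 = 1 - g s\<^sup>2\<close> with \<open>b = W\<^sup>2 - 4(U-1)\<^sup>2\<close> and \<open>g = W\<^sup>2 - 4(U+1)\<^sup>2\<close>, with the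
  addition law of the functions sn, cn, dn, acts on it. If the Jacobi curve has infinitely many
  rational points, then by compactness it has nonzero rational points arbitrarily close to the
  identity; moving the degenerate triangle by them yields infinitely many genuine triangles.

  It remains to find a point of infinite order, uniformly in \<open>u\<close> and \<open>w\<close> and without a bound on
  torsion. A point that is congruent to the identity modulo a suitable power of a prime \<open>p\<close> has
  infinite order, because multiplication by \<open>p\<close> raises the valuation of \<open>s\<close> by exactly one. Explicit
  points attached to \<open>z = u\<^sup>2w\<close> have this property whenever \<open>p\<close> divides the numerator of \<open>z\<^sup>2 - 1\<close> to a
  higher power than that of \<open>u\<^sup>2 - 1\<close>; the same holds for \<open>z = u\<^sup>2/w\<close>. If this fails for all \<open>p\<close>, both
  numerators divide four times that of \<open>u\<^sup>2 - 1\<close>, so \<open>u\<^sup>2w\<close> and \<open>u\<^sup>2/w\<close> have small height compared to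
  \<open>u\<close>; as their product is \<open>u\<^sup>4\<close>, the numerator of \<open>u\<close> is at most 8.
\<close>

subsection \<open>The p-adic valuation on the rationals\<close>


definition pval :: "int \<Rightarrow> rat \<Rightarrow> int" where
  "pval p x = int (multiplicity p (fst (quotient_of x))) - int (multiplicity p (snd (quotient_of x)))"

text \<open>Congruence to zero modulo the \<open>k\<close>-th power of \<open>p\<close>. Zero is
  listed separately because \<open>pval p 0\<close> is 0 and not infinite.\<close>

definition pdiv :: "int \<Rightarrow> int \<Rightarrow> rat \<Rightarrow> bool" where
  "pdiv p k x \<longleftrightarrow> x = 0 \<or> k \<le> pval p x"

lemma prime_multiplicity_mult:
  "prime p \<Longrightarrow> x \<noteq> 0 \<Longrightarrow> y \<noteq> 0 \<Longrightarrow>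
    multiplicity p (x * y) = multiplicity p x + multiplicity p (y :: int)"
  by (intro prime_elem_multiplicity_mult_distrib) auto

lemma pval_of_int_divide:
  assumes "prime p" "a \<noteq> 0" "b \<noteq> 0"
  shows "pval p (of_int a / of_int b) = int (multiplicity p a) - int (multiplicity p b)"
proof -
  obtain n d where nd: "quotient_of (of_int a / of_int b) = (n, d)" by fastforce
  have d: "d > 0" using quotient_of_denom_pos[OF nd] .
  have eq: "(of_int a / of_int b :: rat) = of_int n / of_int d" using quotient_of_div[OF nd] .
  have n: "n \<noteq> 0" using eq assms d by auto
  have "(of_int (a * d) :: rat) = of_int (n * b)" using eq assms d by (simp add: field_simps)
  hence "a * d = n * b" by linarith
  hence "multiplicity p (a * d) = multiplicity p (n * b)" by simp
  hence "multiplicity p a + multiplicity p d = multiplicity p n + multiplicity p b"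
    using assms n d by (simp add: prime_multiplicity_mult)
  thus ?thesis unfolding pval_def nd by simp
qed

lemma rat_as_fraction:
  obtains a b where "b \<noteq> 0" "(x::rat) = of_int a / of_int b"
proof -
  obtain n d where nd: "quotient_of x = (n, d)" by fastforce
  show ?thesis
    using that[of d n] quotient_of_denom_pos[OF nd] quotient_of_div[OF nd] by auto
qed

lemma pval_of_int: "prime p \<Longrightarrow> a \<noteq> 0 \<Longrightarrow> pval p (of_int a) = int (multiplicity p a)"
  using pval_of_int_divide[of p a 1] by simp

lemma pval_1 [simp]: "prime p \<Longrightarrow> pval p 1 = 0"
  using pval_of_int[of p 1] by simp

lemma pval_mult:
  assumes "prime p" "x \<noteq> 0" "y \<noteq> 0"
  shows "pval p (x * y) = pval p x + pval p y"
proof -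
  obtain a b where x: "b \<noteq> 0" "x = of_int a / of_int b" by (rule rat_as_fraction)
  obtain a' b' where y: "b' \<noteq> 0" "y = of_int a' / of_int b'" by (rule rat_as_fraction)
  have nz: "a \<noteq> 0" "a' \<noteq> 0" using assms x y by auto
  have "x * y = of_int (a * a') / of_int (b * b')" using x y by simp
  hence "pval p (x * y) = int (multiplicity p (a * a')) - int (multiplicity p (b * b'))"
    using pval_of_int_divide[of p "a * a'" "b * b'"] assms nz x(1) y(1) by simp
  also have "\<dots> = pval p x + pval p y"
    unfolding x(2) y(2) using assms nz x(1) y(1)
    by (simp add: pval_of_int_divide prime_multiplicity_mult)
  finally show ?thesis .
qed

lemma pval_power:
  assumes "prime p" "x \<noteq> 0"
  shows "pval p (x ^ n) = int n * pval p x"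
  using assms by (induction n) (auto simp: pval_mult algebra_simps)

lemma pval_inverse:
  assumes "prime p" "x \<noteq> 0"
  shows "pval p (inverse x) = - pval p x"
  using pval_mult[of p x "inverse x"] assms by simp

lemma pval_divide:
  assumes "prime p" "x \<noteq> 0" "y \<noteq> 0"
  shows "pval p (x / y) = pval p x - pval p y"
  using pval_mult[of p x "inverse y"] pval_inverse[of p y] assms by (simp add: divide_inverse)

lemma pval_minus:
  assumes "prime p" shows "pval p (- x) = pval p x"
proof (cases "x = 0")
  case False
  have "pval p (- 1) = 0" using pval_of_int[of p "-1"] assms by (simp add: multiplicity_unit_right)
  thus ?thesis using pval_mult[of p "-1" x] assms False by simp
qed simp

lemma pdiv_0 [simp]: "pdiv p k 0" by (simp add: pdiv_def)

lemma pdiv_mono: "pdiv p k x \<Longrightarrow> j \<le> k \<Longrightarrow> pdiv p j x"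
  by (auto simp: pdiv_def)

lemma pdiv_mult: "prime p \<Longrightarrow> pdiv p j x \<Longrightarrow> pdiv p k y \<Longrightarrow> pdiv p (j + k) (x * y)"
  by (cases "x = 0 \<or> y = 0") (auto simp: pdiv_def pval_mult)

lemma pdiv_mult_left: "prime p \<Longrightarrow> pdiv p 0 x \<Longrightarrow> pdiv p k y \<Longrightarrow> pdiv p k (x * y)"
  using pdiv_mult[of p 0 x k y] by simp

lemma pdiv_mult_right: "prime p \<Longrightarrow> pdiv p k x \<Longrightarrow> pdiv p 0 y \<Longrightarrow> pdiv p k (x * y)"
  using pdiv_mult[of p k x 0 y] by simp

lemma pdiv_minus_iff [simp]: "prime p \<Longrightarrow> pdiv p k (- x) \<longleftrightarrow> pdiv p k x"
  by (simp add: pdiv_def pval_minus)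

lemma pdiv_add:
  assumes "prime p" "pdiv p k x" "pdiv p k y"
  shows "pdiv p k (x + y)"
proof (cases "x = 0 \<or> y = 0 \<or> x + y = 0")
  case True
  thus ?thesis using assms by auto
next
  case False
  obtain a b where x: "b \<noteq> 0" "x = of_int a / of_int b" by (rule rat_as_fraction)
  obtain a' b' where y: "b' \<noteq> 0" "y = of_int a' / of_int b'" by (rule rat_as_fraction)
  define m n d where mn: "m = a * b'" "n = a' * b" "d = b * b'"
  have d: "d \<noteq> 0" using x y mn by simp
  have xy: "x = of_int m / of_int d" "y = of_int n / of_int d" "x + y = of_int (m + n) / of_int d"
    using x y mn by (simp_all add: field_simps)
  have nz: "m \<noteq> 0" "n \<noteq> 0" "m + n \<noteq> 0" using False xy by auto
  define l where "l = min (multiplicity p m) (multiplicity p n)"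
  have "p ^ l dvd m" "p ^ l dvd n" by (auto simp: l_def intro: multiplicity_dvd')
  hence "p ^ l dvd m + n" by (rule dvd_add)
  hence "l \<le> multiplicity p (m + n)"
    using nz assms(1) by (intro multiplicity_geI) auto
  moreover have "pval p x = int (multiplicity p m) - int (multiplicity p d)"
    "pval p y = int (multiplicity p n) - int (multiplicity p d)"
    "pval p (x + y) = int (multiplicity p (m + n)) - int (multiplicity p d)"
    unfolding xy(3) unfolding xy(1,2) by (rule pval_of_int_divide; use nz d assms(1) in simp)+
  moreover have "k \<le> pval p x" "k \<le> pval p y" using assms False by (auto simp: pdiv_def)
  ultimately show ?thesis unfolding pdiv_def l_def by linarith
qed

lemma pdiv_diff: "prime p \<Longrightarrow> pdiv p k x \<Longrightarrow> pdiv p k y \<Longrightarrow> pdiv p k (x - y)"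
  using pdiv_add[of p k x "- y"] by simp

lemma pdiv_of_int [simp]: "prime p \<Longrightarrow> pdiv p 0 (of_int a)"
  by (cases "a = 0") (auto simp: pdiv_def pval_of_int)

lemma pdiv_of_nat [simp]: "prime p \<Longrightarrow> pdiv p 0 (of_nat a)"
  using pdiv_of_int[of p "int a"] by simp

lemma pdiv_numeral [simp]: "prime p \<Longrightarrow> pdiv p 0 (numeral a)"
  using pdiv_of_int[of p "numeral a"] by simp

lemma pdiv_1 [simp]: "prime p \<Longrightarrow> pdiv p 0 1"
  using pdiv_of_int[of p 1] by simp

lemma pdiv_power_0: "prime p \<Longrightarrow> pdiv p 0 x \<Longrightarrow> pdiv p 0 (x ^ n)"
  by (induction n) (auto intro: pdiv_mult_left)

text \<open>A sum of larger valuation would force the same on \<open>x = (x + y) - y\<close>. This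
  is how denominators are shown to be nonzero and get their valuation from a dominant term.\<close>

lemma pval_add_eq:
  assumes "prime p" "x \<noteq> 0" "pdiv p (pval p x + 1) y"
  shows "x + y \<noteq> 0" "pval p (x + y) = pval p x"
proof -
  have "\<not> pdiv p (pval p x + 1) x" using assms by (simp add: pdiv_def)
  hence *: "\<not> pdiv p (pval p x + 1) (x + y)"
    using pdiv_diff[OF assms(1) _ assms(3), of "x + y"] by auto
  thus "x + y \<noteq> 0" by auto
  have "pdiv p (pval p x) y" using assms(3) by (rule pdiv_mono) simp
  hence "pdiv p (pval p x) (x + y)" using assms by (intro pdiv_add) (auto simp: pdiv_def)
  with * show "pval p (x + y) = pval p x" by (auto simp: pdiv_def)
qed

lemma pdiv_prime: "prime p \<Longrightarrow> pdiv p 1 (of_int p)"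
  using multiplicity_prime[OF prime_imp_prime_elem, of p] by (simp add: pdiv_def pval_of_int)

subsection \<open>The Jacobi curve and its addition law\<close>


text \<open>Here \<open>(s, c, d)\<close> plays the role of \<open>(sn, cn, dn)\<close>; the identity of the group is \<open>(0, 1, 1)\<close>.\<close>
definition on_jacobi :: "'a::field \<Rightarrow> 'a \<Rightarrow> 'a \<times> 'a \<times> 'a \<Rightarrow> bool" where
  "on_jacobi b g = (\<lambda>(s, c, d). c\<^sup>2 = 1 - b * s\<^sup>2 \<and> d\<^sup>2 = 1 - g * s\<^sup>2)"

text \<open>The addition theorem of sn, cn, dn with two parameters; \<open>b = 1\<close> and
  \<open>g\<close> the squared modulus give the classical formulas.\<close>

definition jacobi_add :: "'a::field \<Rightarrow> 'a \<Rightarrow> 'a \<times> 'a \<times> 'a \<Rightarrow> 'a \<times> 'a \<times> 'a \<Rightarrow> 'a \<times> 'a \<times> 'a" where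
  "jacobi_add b g = (\<lambda>(s1, c1, d1) (s2, c2, d2).
     let D = 1 - b * g * s1\<^sup>2 * s2\<^sup>2 in
       ((s1 * c2 * d2 + s2 * c1 * d1) / D,
        (c1 * c2 - b * s1 * d1 * s2 * d2) / D,
        (d1 * d2 - g * s1 * c1 * s2 * c2) / D))"

text \<open>The mixed terms of the two squares cancel, and the rest involves squares only.
  Exchanging the roles of \<open>b\<close>, \<open>c\<close> and \<open>g\<close>, \<open>d\<close>
  gives the companion identity for the third coordinate.\<close>

lemma on_jacobi_add_aux:
  fixes b g :: "'a::field"
  assumes "c1\<^sup>2 = 1 - b * s1\<^sup>2" "d1\<^sup>2 = 1 - g * s1\<^sup>2" "c2\<^sup>2 = 1 - b * s2\<^sup>2" "d2\<^sup>2 = 1 - g * s2\<^sup>2"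
  shows "(c1 * c2 - b * s1 * d1 * s2 * d2)\<^sup>2 =
    (1 - b * g * s1\<^sup>2 * s2\<^sup>2)\<^sup>2 - b * (s1 * c2 * d2 + s2 * c1 * d1)\<^sup>2"
proof -
  have "(c1 * c2 - b * s1 * d1 * s2 * d2)\<^sup>2 + b * (s1 * c2 * d2 + s2 * c1 * d1)\<^sup>2
     = c1\<^sup>2 * c2\<^sup>2 + b\<^sup>2 * s1\<^sup>2 * s2\<^sup>2 * d1\<^sup>2 * d2\<^sup>2 + b * s1\<^sup>2 * c2\<^sup>2 * d2\<^sup>2 + b * s2\<^sup>2 * c1\<^sup>2 * d1\<^sup>2"
    by algebra
  also have "\<dots> = (1 - b * g * s1\<^sup>2 * s2\<^sup>2)\<^sup>2" unfolding assms by algebra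
  finally show ?thesis by (simp add: eq_diff_eq)
qed

lemma on_jacobi_add:
  fixes b g :: "'a::field"
  assumes "on_jacobi b g (s1, c1, d1)" "on_jacobi b g (s2, c2, d2)"
    and "1 - b * g * s1\<^sup>2 * s2\<^sup>2 \<noteq> 0"
  shows "on_jacobi b g (jacobi_add b g (s1, c1, d1) (s2, c2, d2))"
proof -
  define D where "D = 1 - b * g * s1\<^sup>2 * s2\<^sup>2"
  have D: "D \<noteq> 0" using assms D_def by simp
  have *: "c1\<^sup>2 = 1 - b * s1\<^sup>2" "d1\<^sup>2 = 1 - g * s1\<^sup>2" "c2\<^sup>2 = 1 - b * s2\<^sup>2" "d2\<^sup>2 = 1 - g * s2\<^sup>2"
    using assms by (auto simp: on_jacobi_def)
  have 1: "(c1 * c2 - b * s1 * d1 * s2 * d2)\<^sup>2 = D\<^sup>2 - b * (s1 * c2 * d2 + s2 * c1 * d1)\<^sup>2"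
    unfolding D_def using * by (rule on_jacobi_add_aux)
  have "(d1 * d2 - g * s1 * c1 * s2 * c2)\<^sup>2 =
     (1 - g * b * s1\<^sup>2 * s2\<^sup>2)\<^sup>2 - g * (s1 * d2 * c2 + s2 * d1 * c1)\<^sup>2"
    by (rule on_jacobi_add_aux) (use * in auto)
  hence 2: "(d1 * d2 - g * s1 * c1 * s2 * c2)\<^sup>2 = D\<^sup>2 - g * (s1 * c2 * d2 + s2 * c1 * d1)\<^sup>2"
    unfolding D_def by (simp add: mult_ac)
  have frac: "(m / D)\<^sup>2 = 1 - e * (n / D)\<^sup>2" if "m\<^sup>2 = D\<^sup>2 - e * n\<^sup>2" for m n e :: 'a
    using that D by (simp add: power_divide divide_simps)
  show ?thesis
    using frac[OF 1] frac[OF 2] by (simp add: on_jacobi_def jacobi_add_def D_def Let_def)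
qed

primrec jacobi_mul :: "'a::field \<Rightarrow> 'a \<Rightarrow> 'a \<times> 'a \<times> 'a \<Rightarrow> nat \<Rightarrow> 'a \<times> 'a \<times> 'a" where
  "jacobi_mul b g Q 0 = (0, 1, 1)"
| "jacobi_mul b g Q (Suc n) = jacobi_add b g (jacobi_mul b g Q n) Q"

section \<open>Multiples of a point p-adically close to the identity\<close>

lemma pdiv_unit_divide:
  assumes "prime p" "pdiv p 1 (D - 1)" "pdiv p k x"
  shows "D \<noteq> 0" "pdiv p k (x / D)"
proof -
  have "D \<noteq> 0 \<and> pval p D = 0"
    using pval_add_eq[of p 1 "D - 1"] assms by simp
  thus "D \<noteq> 0" "pdiv p k (x / D)"
    using assms by (cases "x = 0"; auto simp: pdiv_def pval_divide)+
qed

lemma pdiv_cong_mult: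
  assumes "prime p" "pdiv p k (x - x')" "pdiv p k (y - y')" "pdiv p 0 x'" "pdiv p 0 y"
  shows "pdiv p k (x * y - x' * y')"
proof -
  have "x * y - x' * y' = (x - x') * y + x' * (y - y')" by (simp add: algebra_simps)
  moreover have "pdiv p k ((x - x') * y)" "pdiv p k (x' * (y - y'))"
    using assms pdiv_mult_right[of p k "x - x'" y] pdiv_mult_left[of p x' k "y - y'"] by auto
  ultimately show ?thesis using assms(1) by (auto intro: pdiv_add)
qed

lemma pdiv_cong_trans:
  assumes "prime p" "pdiv p k (x - y)" "pdiv p k (y - z)"
  shows "pdiv p k (x - z)"
  using pdiv_add[OF assms] by simp

lemma pdiv_cong_integral:
  assumes "prime p" "0 \<le> k" "pdiv p k (x - y)" "pdiv p 0 y"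
  shows "pdiv p 0 x"
  using pdiv_add[OF assms(1) pdiv_mono[OF assms(3,2)] assms(4)] by simp

text \<open>The correction term is the second-order part of the formal multiplication by \<open>n\<close>; it is
  needed because the hypothesis only provides congruences modulo \<open>p\<close>, not modulo \<open>p\<^sup>2\<close>.\<close>
lemma jacobi_mul_cong:
  fixes b g s c d :: rat
  assumes p: "prime p" and on: "on_jacobi b g (s, c, d)" and x: "pdiv p 1 (1 - c)" and y: "pdiv p 1 (1 - d)"
  defines "\<tau> \<equiv> \<lambda>n. (\<Sum>k<n. of_nat (k * (k + 1)) :: rat)"
  shows "\<exists>r c' d'. jacobi_mul b g (s, c, d) n = (r * s, c', d') \<and>
     on_jacobi b g (r * s, c', d') \<and>
     pdiv p 2 (r - (of_nat n - ((1 - c) + (1 - d)) * \<tau> n)) \<and>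
     pdiv p 2 (c' - (1 - of_nat (n\<^sup>2) * (1 - c))) \<and> pdiv p 2 (d' - (1 - of_nat (n\<^sup>2) * (1 - d)))"
proof (induction n)
  case 0
  show ?case by (rule exI[of _ 0], rule exI[of _ 1], rule exI[of _ 1]) (simp add: \<tau>_def on_jacobi_def)
next
  case (Suc n)
  define x y where "x = 1 - c" and "y = 1 - d"
  define N :: rat where "N = of_nat n"
  define T where "T = \<tau> n"
  have [simp]: "\<tau> (Suc n) = T + N * (N + 1)" by (simp add: \<tau>_def T_def N_def algebra_simps)
  from Suc obtain r c' d' where IH: "jacobi_mul b g (s, c, d) n = (r * s, c', d')"
      "on_jacobi b g (r * s, c', d')" "pdiv p 2 (r - (N - (x + y) * T))"
      "pdiv p 2 (c' - (1 - N\<^sup>2 * x))" "pdiv p 2 (d' - (1 - N\<^sup>2 * y))"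
    unfolding x_def y_def N_def T_def by (auto simp: power2_eq_square)
  have X: "pdiv p 1 x" "pdiv p 1 y" using assms by (auto simp: x_def y_def)
  have X0: "pdiv p 0 x" "pdiv p 0 y" using X by (auto elim: pdiv_mono)
  have N0: "pdiv p 0 N" "pdiv p 0 T"
    unfolding N_def T_def \<tau>_def of_nat_sum[symmetric] by (rule pdiv_of_nat[OF p])+
  have cd: "c = 1 - x" "d = 1 - y" by (auto simp: x_def y_def)
  have int1: "pdiv p 0 (1 :: rat)" using p by simp
  have XX: "pdiv p 2 (x * x)" "pdiv p 2 (x * y)" "pdiv p 2 (y * y)"
    using pdiv_mult[OF p X(1) X(1)] pdiv_mult[OF p X(1) X(2)] pdiv_mult[OF p X(2) X(2)] by auto
  \<comment> \<open>As \<open>b\<close>, \<open>g\<close> and \<open>s\<close> may have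
    \<open>p\<close> in their denominators, the first coordinate of a multiple is written
    \<open>r * s\<close>. Then only \<open>B\<close> and \<open>G\<close> enter, which are
    \<open>1 - c\<^sup>2\<close> and \<open>1 - d\<^sup>2\<close> and hence \<open>2 * x\<close> and
    \<open>2 * y\<close> modulo \<open>p\<^sup>2\<close>.\<close>
  define B G where "B = b * s\<^sup>2" and "G = g * s\<^sup>2"
  have "c\<^sup>2 = 1 - B" "d\<^sup>2 = 1 - G" using on by (auto simp: on_jacobi_def B_def G_def)
  hence BG: "B - 2 * x = - (x * x)" "G - 2 * y = - (y * y)"
    unfolding cd power2_eq_square by (auto simp: algebra_simps)
  have BGc: "pdiv p 2 (B - 2 * x)" "pdiv p 2 (G - 2 * y)"
    unfolding BG using XX p by auto
  have twox: "pdiv p 1 (2 * x)" "pdiv p 1 (2 * y)"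
    using p X by (auto intro!: pdiv_mult_left)
  have B1: "pdiv p 1 B" "pdiv p 1 G"
    using pdiv_add[OF p twox(1) pdiv_mono[OF BGc(1)]] pdiv_add[OF p twox(2) pdiv_mono[OF BGc(2)]] by auto
  have R0: "pdiv p 0 (N - (x + y) * T)"
    using p X0 N0 by (auto intro!: pdiv_diff pdiv_mult_left pdiv_add)
  have r0: "pdiv p 0 r" using pdiv_cong_integral[OF p _ IH(3) R0] by simp
  have c0: "pdiv p 0 (1 - N\<^sup>2 * x)" "pdiv p 0 (1 - N\<^sup>2 * y)"
    using p X0 N0 by (auto intro!: pdiv_diff pdiv_mult_left pdiv_power_0)
  have c'0: "pdiv p 0 c'" "pdiv p 0 d'"
    using pdiv_cong_integral[OF p _ IH(4) c0(1)] pdiv_cong_integral[OF p _ IH(5) c0(2)] by auto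
  have cd0: "pdiv p 0 c" "pdiv p 0 d" unfolding cd using p X0 by (auto intro!: pdiv_diff)
  \<comment> \<open>The denominator of the next addition is 1 modulo \<open>p\<^sup>2\<close>, so
    dividing by it preserves the congruences.\<close>
  define D where "D = 1 - B * G * r\<^sup>2"
  have BGr: "pdiv p 2 (B * G * r\<^sup>2)"
    using pdiv_mult[OF p B1] r0 p by (auto intro!: pdiv_mult_right pdiv_power_0)
  have D2: "pdiv p 2 (1 - D)" unfolding D_def using BGr by simp
  have D1: "pdiv p 1 (D - 1)"
    using pdiv_mono[OF D2, of 1] p pdiv_minus_iff[OF p, of 1 "1 - D"] by simp
  have D0: "D \<noteq> 0" by (rule pdiv_unit_divide(1)[OF p D1 int1])
  have divD: "pdiv p 2 (M / D - M')" if "pdiv p 2 (M - M')" "pdiv p 0 M'" for M M'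
  proof -
    have M0: "pdiv p 0 M" using pdiv_cong_integral[OF p _ that] by simp
    have "M / D - M = M * (1 - D) / D" using D0 by (simp add: field_simps)
    moreover have "pdiv p 2 (M * (1 - D) / D)"
      using M0 D2 p D1 by (auto intro!: pdiv_unit_divide(2) pdiv_mult_left)
    ultimately show ?thesis using pdiv_cong_trans[OF p _ that(1), of "M / D"] by simp
  qed
  have D_eq: "1 - b * g * (r * s)\<^sup>2 * s\<^sup>2 = D"
    unfolding D_def B_def G_def by (simp add: power_mult_distrib mult_ac)
  define r1 where "r1 = (r * (c * d) + c' * d') / D"
  define c1 where "c1 = (c' * c - B * (r * d' * d)) / D"
  define d1 where "d1 = (d' * d - G * (r * c' * c)) / D"
  have add_eq: "jacobi_add b g (r * s, c', d') (s, c, d) = (r1 * s, c1, d1)"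
    unfolding jacobi_add_def case_prod_conv Let_def D_eq r1_def c1_def d1_def B_def G_def
    by (simp add: power2_eq_square mult_ac add_divide_distrib distrib_left)
  have on1: "on_jacobi b g (r1 * s, c1, d1)"
    using on_jacobi_add[OF IH(2) on] D0 unfolding D_eq add_eq by simp

  have c'1: "pdiv p 1 (c' - 1)" "pdiv p 1 (d' - 1)"
  proof -
    have "pdiv p 1 ((c' - (1 - N\<^sup>2 * x)) - N\<^sup>2 * x)" "pdiv p 1 ((d' - (1 - N\<^sup>2 * y)) - N\<^sup>2 * y)"
      by (rule pdiv_diff[OF p pdiv_mono[OF IH(4)]] pdiv_diff[OF p pdiv_mono[OF IH(5)]];
          use p N0 X in \<open>auto intro!: pdiv_mult_left pdiv_power_0\<close>)+
    thus "pdiv p 1 (c' - 1)" "pdiv p 1 (d' - 1)" by simp_all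
  qed
  have r1N: "pdiv p 1 (r - N)"
  proof -
    have "pdiv p 1 ((r - (N - (x + y) * T)) - (x + y) * T)"
      by (rule pdiv_diff[OF p pdiv_mono[OF IH(3)]]; use p N0 X in \<open>auto intro!: pdiv_mult_right pdiv_add\<close>)
    thus ?thesis by simp
  qed
  have cdm1: "pdiv p 1 (c - 1)" "pdiv p 1 (d - 1)"
    unfolding cd using X p by simp_all
  have rdd: "pdiv p 1 (r * d' * d - N)" "pdiv p 1 (r * c' * c - N)"
  proof -
    have "pdiv p 1 (r * d' - N * 1)" "pdiv p 1 (r * c' - N * 1)"
      by (rule pdiv_cong_mult; use p r1N c'1 N0 c'0 in simp)+
    hence "pdiv p 1 ((r * d') * d - (N * 1) * 1)" "pdiv p 1 ((r * c') * c - (N * 1) * 1)"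
      by - (rule pdiv_cong_mult; use p cdm1 N0 cd0 in simp)+
    thus "pdiv p 1 (r * d' * d - N)" "pdiv p 1 (r * c' * c - N)" by simp_all
  qed

  \<comment> \<open>One computation for both \<open>c\<close> and \<open>d\<close>: with
    \<open>B\<close> close to \<open>2 * x\<close> and \<open>m\<close> close to \<open>N\<close>,
    the multiples of \<open>x\<close> add up to \<open>N\<^sup>2 + 1 + 2 * N\<close>, which is
    \<open>(N + 1)\<^sup>2\<close>.\<close>
  have cos_step: "pdiv p 2 ((c' * (1 - x) - B * m) - (1 - (N + 1)\<^sup>2 * x))"
    if "pdiv p 1 x" "pdiv p 2 (x * x)" "pdiv p 0 x" "pdiv p 2 (c' - (1 - N\<^sup>2 * x))"
      "pdiv p 2 (B - 2 * x)" "pdiv p 1 (m - N)" for x B c' m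
  proof -
    have m0: "pdiv p 0 m" using pdiv_cong_integral[OF p _ that(6)] N0 by simp
    have "(c' * (1 - x) - B * m) - (1 - (N + 1)\<^sup>2 * x) =
        (c' - (1 - N\<^sup>2 * x)) * (1 - x) + N\<^sup>2 * (x * x) - (B - 2 * x) * m - 2 * (x * (m - N))"
      by (simp add: power2_eq_square algebra_simps)
    moreover have "pdiv p 2 (x * (m - N))" using pdiv_mult[OF p that(1,6)] by simp
    moreover have "pdiv p 2 ((c' - (1 - N\<^sup>2 * x)) * (1 - x))" "pdiv p 2 (N\<^sup>2 * (x * x))"
        "pdiv p 2 ((B - 2 * x) * m)"
      using pdiv_mult_right[OF p that(4), of "1 - x"] pdiv_diff[OF p int1 that(3)]
        pdiv_mult_left[OF p pdiv_power_0[OF p N0(1)] that(2)] pdiv_mult_right[OF p that(5) m0] by auto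
    ultimately show ?thesis
      using pdiv_diff[OF p pdiv_diff[OF p pdiv_add[OF p]]]
        pdiv_mult_left[OF p pdiv_numeral[OF p]] by metis
  qed
  have cN: "pdiv p 2 (c' * c - B * (r * d' * d) - (1 - (N + 1)\<^sup>2 * x))"
    unfolding cd(1) by (rule cos_step) (use X XX X0 IH BGc rdd in auto)
  have dN: "pdiv p 2 (d' * d - G * (r * c' * c) - (1 - (N + 1)\<^sup>2 * y))"
    unfolding cd(2) by (rule cos_step) (use X XX X0 IH BGc rdd in \<open>auto simp: cd\<close>)

  have e1: "pdiv p 2 (c * d - (1 - (x + y)))"
  proof -
    have "c * d - (1 - (x + y)) = x * y" unfolding cd by (simp add: algebra_simps)
    thus ?thesis using XX by simp
  qed
  have e2: "pdiv p 2 (r * (c * d) - (N - (x + y) * T) * (1 - (x + y)))"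
    by (rule pdiv_cong_mult) (use p IH e1 R0 cd0 in \<open>auto intro: pdiv_mult_left\<close>)
  have e3: "pdiv p 2 (c' * d' - (1 - N\<^sup>2 * x) * (1 - N\<^sup>2 * y))"
    by (rule pdiv_cong_mult) (use p IH c0 c'0 in auto)
  \<comment> \<open>Modulo \<open>p\<^sup>2\<close> quadratic terms in \<open>x\<close>,
    \<open>y\<close> vanish. What multiplies \<open>x + y\<close> is
    \<open>T + N + N\<^sup>2\<close>, the recurrence of the sums \<open>\<tau>\<close>.\<close>
  have e4: "pdiv p 2 ((N - (x + y) * T) * (1 - (x + y)) + (1 - N\<^sup>2 * x) * (1 - N\<^sup>2 * y)
      - ((N + 1) - (x + y) * (T + N * (N + 1))))"
  proof -
    have "(N - (x + y) * T) * (1 - (x + y)) + (1 - N\<^sup>2 * x) * (1 - N\<^sup>2 * y)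
      - ((N + 1) - (x + y) * (T + N * (N + 1))) =
      T * (x * x + 2 * (x * y) + y * y) + N\<^sup>2 * (N\<^sup>2 * (x * y))"
      by (simp add: power2_eq_square algebra_simps)
    moreover have "pdiv p 2 (x * x + 2 * (x * y) + y * y)"
      by (intro pdiv_add[OF p] XX pdiv_mult_left[OF p pdiv_numeral[OF p]])
    ultimately show ?thesis using pdiv_add[OF p] pdiv_mult_left[OF p N0(2)]
        pdiv_mult_left[OF p pdiv_power_0[OF p N0(1)]] XX(2) by metis
  qed
  have rN: "pdiv p 2 (r * (c * d) + c' * d' - ((N + 1) - (x + y) * (T + N * (N + 1))))"
    using pdiv_add[OF p pdiv_add[OF p e2 e3] e4] by (simp add: algebra_simps)
  have fin: "pdiv p 2 (r1 - ((N + 1) - (x + y) * (T + N * (N + 1))))"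
     "pdiv p 2 (c1 - (1 - (N + 1)\<^sup>2 * x))" "pdiv p 2 (d1 - (1 - (N + 1)\<^sup>2 * y))"
    unfolding r1_def c1_def d1_def
    by (rule divD[OF rN] divD[OF cN] divD[OF dN];
        use p X0 N0 in \<open>auto intro!: pdiv_add pdiv_diff pdiv_mult_left pdiv_power_0\<close>)+
  show ?case
    by (rule exI[of _ r1], rule exI[of _ c1], rule exI[of _ d1])
       (use fin on1 add_eq IH(1) in \<open>simp add: x_def[symmetric] y_def[symmetric] N_def add.commute\<close>)
qed


text \<open>For \<open>n\<close> a prime \<open>p \<ge> 5\<close> the number 3 is invertible, so the
  sum is divisible by \<open>p\<close>.\<close>

lemma sum_mult_Suc: "3 * (\<Sum>k<n. of_nat (k * (k + 1)) :: rat) = of_nat n * (of_nat n + 1) * (of_nat n - 1)"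
  by (induction n) (simp_all add: algebra_simps)

text \<open>Take the \<open>p\<close>-th multiple. The correction term vanishes modulo
  \<open>p\<^sup>2\<close>: for \<open>k = 2\<close> because of its first factor, for
  \<open>p \<ge> 5\<close> because both factors are divisible by \<open>p\<close>. So
  \<open>r\<close> is \<open>p\<close> modulo \<open>p\<^sup>2\<close> and has valuation exactly 1.
  The new point is congruent to the identity modulo \<open>p\<^sup>2\<close>, which allows
  repetition.\<close>

lemma jacobi_mul_prime:
  fixes b g s c d :: rat
  assumes p: "prime p" and on: "on_jacobi b g (s, c, d)" and s: "s \<noteq> 0"
    and cd: "pdiv p k (1 - c)" "pdiv p k (1 - d)" and k: "k = 2 \<or> k = 1 \<and> p \<ge> 5"
  shows "\<exists>s' c' d'. on_jacobi b g (s', c', d') \<and> s' \<noteq> 0 \<and> pval p s' = pval p s + 1 \<and>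
    pdiv p 2 (1 - c') \<and> pdiv p 2 (1 - d')"
proof -
  define n where "n = nat p"
  have p0: "p > 0" using p by (simp add: prime_gt_0_int)
  have n: "(of_nat n :: rat) = of_int p" using p0 by (simp add: n_def)
  have cd1: "pdiv p 1 (1 - c)" "pdiv p 1 (1 - d)" using cd k by (auto elim: pdiv_mono)
  define T where "T = (\<Sum>k<n. of_nat (k * (k + 1)) :: rat)"
  have T0: "pdiv p 0 T" unfolding T_def of_nat_sum[symmetric] by (rule pdiv_of_nat[OF p])
  have pp: "pdiv p 1 (of_int p)" by (rule pdiv_prime[OF p])
  have pp2: "pdiv p 2 (of_int p ^ 2)" using pdiv_mult[OF p pp pp] by (simp add: power2_eq_square)
  obtain r c' d' where m: "on_jacobi b g (r * s, c', d')"
     "pdiv p 2 (r - (of_nat n - ((1 - c) + (1 - d)) * T))"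
     "pdiv p 2 (c' - (1 - of_nat (n\<^sup>2) * (1 - c)))" "pdiv p 2 (d' - (1 - of_nat (n\<^sup>2) * (1 - d)))"
    using jacobi_mul_cong[OF p on cd1, of n] unfolding T_def by blast
  have corr: "pdiv p 2 (((1 - c) + (1 - d)) * T)"
  proof (cases "k = 2")
    case True
    thus ?thesis using pdiv_mult_right[OF p pdiv_add[OF p cd] T0] by simp
  next
    case False
    hence p5: "p \<ge> 5" using k by simp
    have "\<not> p dvd 3" using p5 zdvd_imp_le[of p 3] by auto
    hence v3: "pval p 3 = 0" using pval_of_int[OF p, of 3] by (simp add: not_dvd_imp_multiplicity_0)
    have "pdiv p 1 (3 * T)"
      unfolding T_def sum_mult_Suc n mult.assoc using p
      by (intro pdiv_mult_right pp) (auto intro!: pdiv_mult_left pdiv_add pdiv_diff)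
    hence "pdiv p 1 T" using v3 pval_mult[OF p, of 3 T] by (cases "T = 0") (auto simp: pdiv_def)
    from pdiv_mult[OF p pdiv_add[OF p cd1] this] show ?thesis by simp
  qed
  have "pdiv p 2 ((r - (of_nat n - ((1 - c) + (1 - d)) * T)) - ((1 - c) + (1 - d)) * T)"
    by (rule pdiv_diff[OF p m(2) corr])
  hence "pdiv p 2 (r - of_int p)" by (simp add: n)
  moreover have "pval p (of_int p) = 1"
    using multiplicity_prime[OF prime_imp_prime_elem, OF p] p0 by (simp add: pval_of_int[OF p])
  ultimately have r: "r \<noteq> 0" "pval p r = 1"
    using pval_add_eq[OF p, of "of_int p" "r - of_int p"] p0 by simp_all
  have one: "pdiv p 2 (1 - e')" if "pdiv p 1 (1 - e)" "pdiv p 2 (e' - (1 - of_nat (n\<^sup>2) * (1 - e)))" for e e'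
  proof -
    have "pdiv p 2 (of_int p ^ 2 * (1 - e))"
      by (rule pdiv_mult_right[OF p pp2 pdiv_mono[OF that(1)]]) simp
    from pdiv_diff[OF p this that(2)] show ?thesis by (simp add: n)
  qed
  show ?thesis
    by (rule exI[of _ "r * s"], rule exI[of _ c'], rule exI[of _ d'])
       (use m(1) r s p one[OF cd1(1) m(3)] one[OF cd1(2) m(4)] in \<open>auto simp: pval_mult\<close>)
qed

text \<open>Repeated multiplication by \<open>p\<close> makes the valuation of \<open>s\<close>
  strictly increase. Signs do not affect valuations, so even the squares are distinct.\<close>

lemma jacobi_infinitely_many:
  fixes b g s c d :: rat
  assumes p: "prime p" and on: "on_jacobi b g (s, c, d)" and s: "s \<noteq> 0"
    and cd: "pdiv p k (1 - c)" "pdiv p k (1 - d)" and k: "k = 2 \<or> k = 1 \<and> p \<ge> 5"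
  shows "\<exists>f :: nat \<Rightarrow> rat \<times> rat \<times> rat. (\<forall>n. on_jacobi b g (f n)) \<and> inj (\<lambda>n. (fst (f n))\<^sup>2)"
proof -
  define P where "P = (\<lambda>(s, c, d). on_jacobi b g (s, c, d) \<and> s \<noteq> 0 \<and> pdiv p 2 (1 - c) \<and> pdiv p 2 (1 - d))"
  have "\<exists>x. P x" using jacobi_mul_prime[OF assms] unfolding P_def by blast
  moreover have "\<exists>y. P y \<and> pval p (fst y) = pval p (fst x) + 1" if "P x" for x
  proof -
    obtain s c d where x: "x = (s, c, d)" by (cases x)
    have "on_jacobi b g (s, c, d)" "s \<noteq> 0" "pdiv p 2 (1 - c)" "pdiv p 2 (1 - d)"
      using that unfolding P_def x by auto
    from jacobi_mul_prime[OF p this] obtain s' c' d' where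
      "on_jacobi b g (s', c', d')" "s' \<noteq> 0" "pval p s' = pval p s + 1" "pdiv p 2 (1 - c')" "pdiv p 2 (1 - d')"
      by auto
    thus ?thesis unfolding P_def x by (intro exI[of _ "(s', c', d')"]) simp
  qed
  ultimately have "\<exists>f. \<forall>n. P (f n) \<and> pval p (fst (f (Suc n))) = pval p (fst (f n)) + 1"
    by (intro dependent_nat_choice)
  then obtain f where f: "\<And>n. P (f n)" "\<And>n. pval p (fst (f (Suc n))) = pval p (fst (f n)) + 1"
    by blast
  have v: "pval p (fst (f n)) = pval p (fst (f 0)) + int n" for n
    by (induction n) (auto simp: f(2))
  have "inj (\<lambda>n. (fst (f n))\<^sup>2)"
  proof (rule injI)
    fix i j assume "(fst (f i))\<^sup>2 = (fst (f j))\<^sup>2"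
    hence "fst (f i) = fst (f j) \<or> fst (f i) = - fst (f j)" by (simp add: power2_eq_iff)
    hence "pval p (fst (f i)) = pval p (fst (f j))" using pval_minus[OF p] by metis
    thus "i = j" using v[of i] v[of j] by simp
  qed
  moreover have "on_jacobi b g (f n)" for n using f(1)[of n] unfolding P_def by (cases "f n") auto
  ultimately show ?thesis by blast
qed

subsection \<open>Points of the Jacobi curve coming from degenerate triangles\<close>


text \<open>The Jacobi curve with coefficients \<open>jb u w\<close> and \<open>jg u w\<close> is two-isogenous to the median curve
  \<open>w + 1/w + v + 1/v = (u + 1/u) (t + 1/t)\<close>.\<close>
definition jb :: "'a::field \<Rightarrow> 'a \<Rightarrow> 'a" where
  "jb u w = (w + 1 / w)\<^sup>2 - 4 * (u + 1 / u - 1)\<^sup>2"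

definition jg :: "'a::field \<Rightarrow> 'a \<Rightarrow> 'a" where
  "jg u w = (w + 1 / w)\<^sup>2 - 4 * (u + 1 / u + 1)\<^sup>2"

text \<open>Distinct squares of \<open>s\<close> ensure that the difference of two of the points has
  nonzero first coordinate.\<close>

definition jacobi_infinite :: "rat \<Rightarrow> rat \<Rightarrow> bool" where
  "jacobi_infinite b g \<longleftrightarrow>
    (\<exists>f :: nat \<Rightarrow> rat \<times> rat \<times> rat. (\<forall>n. on_jacobi b g (f n)) \<and> inj (\<lambda>n. (fst (f n))\<^sup>2))"

definition jden :: "'a::field \<Rightarrow> 'a \<Rightarrow> 'a" where
  "jden u z = (u\<^sup>2 + 1) * (2 * (u\<^sup>2 - 1)\<^sup>2 + (u\<^sup>2 - 1) * (u\<^sup>2 - 5) * (z\<^sup>2 - 1)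
     - (3 * u\<^sup>2 - 4) * (z\<^sup>2 - 1)\<^sup>2) + (z\<^sup>2 - 1) ^ 3"

text \<open>The image of \<open>(v, t) = (z, z/u)\<close> under the isogeny, with the branch point \<open>v = 1\<close> as origin.
  The denominator is expanded around \<open>z\<^sup>2 = 1\<close>, where the point becomes close to the identity.\<close>
lemma on_jacobi_degenerate_triangle:
  fixes u w z :: "'a::field_char_0"
  assumes "u \<noteq> 0" "z \<noteq> 0" "w = z / u\<^sup>2" "jden u z \<noteq> 0"
  shows "on_jacobi (jb u w) (jg u w)
    ((z\<^sup>2 - 1) * (z\<^sup>2 - u\<^sup>2) * u\<^sup>2 * z / jden u z,
     1 - (z - 1)\<^sup>2 * (z - u)\<^sup>2 * (z\<^sup>2 + u ^ 4 + 2 * u * z * (u\<^sup>2 + 1) - 2 * u\<^sup>2 * z) / jden u z,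
     1 - (z - 1)\<^sup>2 * (z + u)\<^sup>2 * (z\<^sup>2 + u ^ 4 - 2 * u * z * (u\<^sup>2 + 1) - 2 * u\<^sup>2 * z) / jden u z)"
proof -
  define F where "F = jden u z"
  \<comment> \<open>The linear factors of the differences of squares \<open>jb u w\<close> and
    \<open>jg u w\<close>, with denominators cleared.\<close>
  define K1 K2 K3 K4 where "K1 = z\<^sup>2 + u ^ 4 + 2 * u * z * (u\<^sup>2 + 1) - 2 * u\<^sup>2 * z"
    and "K2 = z\<^sup>2 + u ^ 4 - 2 * u * z * (u\<^sup>2 + 1) + 2 * u\<^sup>2 * z"
    and "K3 = z\<^sup>2 + u ^ 4 - 2 * u * z * (u\<^sup>2 + 1) - 2 * u\<^sup>2 * z"
    and "K4 = z\<^sup>2 + u ^ 4 + 2 * u * z * (u\<^sup>2 + 1) + 2 * u\<^sup>2 * z"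
  have W: "w + 1 / w = (z\<^sup>2 + u ^ 4) / (u\<^sup>2 * z)" and U: "u + 1 / u = (u\<^sup>2 + 1) / u"
    unfolding assms(3) using assms(1,2) by (simp_all add: field_simps power2_eq_square power4_eq_xxxx)
  have W2: "u\<^sup>2 * z * (w + 1 / w) = z\<^sup>2 + u ^ 4" unfolding W using assms by simp
  have U2: "u\<^sup>2 * z * (u + 1 / u) = u * z * (u\<^sup>2 + 1)"
    unfolding U using assms by (simp add: power2_eq_square)
  have beta: "(u\<^sup>2 * z)\<^sup>2 * jb u w = K1 * K2"
  proof -
    have "(u\<^sup>2 * z)\<^sup>2 * jb u w = (u\<^sup>2 * z * (w + 1 / w))\<^sup>2 - 4 * (u\<^sup>2 * z * (u + 1 / u) - u\<^sup>2 * z)\<^sup>2"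
      unfolding jb_def by algebra
    also have "\<dots> = K1 * K2" unfolding W2 U2 K1_def K2_def by algebra
    finally show ?thesis .
  qed
  have gamma: "(u\<^sup>2 * z)\<^sup>2 * jg u w = K3 * K4"
  proof -
    have "(u\<^sup>2 * z)\<^sup>2 * jg u w = (u\<^sup>2 * z * (w + 1 / w))\<^sup>2 - 4 * (u\<^sup>2 * z * (u + 1 / u) + u\<^sup>2 * z)\<^sup>2"
      unfolding jg_def by algebra
    also have "\<dots> = K3 * K4" unfolding W2 U2 K3_def K4_def by algebra
    finally show ?thesis .
  qed
  have F1: "2 * F = (z - 1)\<^sup>2 * (z - u)\<^sup>2 * K1 + (z + 1)\<^sup>2 * (z + u)\<^sup>2 * K2"
    unfolding F_def jden_def K1_def K2_def by algebra
  have F2: "2 * F = (z - 1)\<^sup>2 * (z + u)\<^sup>2 * K3 + (z + 1)\<^sup>2 * (z - u)\<^sup>2 * K4"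
    unfolding F_def jden_def K3_def K4_def by algebra
  have F0: "F \<noteq> 0" using assms F_def by simp
  define S where "S = (z\<^sup>2 - 1) * (z\<^sup>2 - u\<^sup>2) * u\<^sup>2 * z"
  \<comment> \<open>\<open>(F - A)\<^sup>2 = F\<^sup>2 - A * (2 * F - A)\<close>, so it is enough to
    split \<open>2 * F\<close> into two summands whose product is
    \<open>e * S\<^sup>2\<close>.\<close>
  have frac: "(1 - A / F)\<^sup>2 = 1 - e * (S / F)\<^sup>2" if "2 * F = A + A'" "e * S\<^sup>2 = A * A'" for A A' e
  proof -
    have "(F - A)\<^sup>2 = F\<^sup>2 - e * S\<^sup>2" using that by algebra
    thus ?thesis using F0 by (simp add: field_simps power2_eq_square)
  qed
  have "jb u w * S\<^sup>2 = ((z - 1)\<^sup>2 * (z - u)\<^sup>2 * K1) * ((z + 1)\<^sup>2 * (z + u)\<^sup>2 * K2)"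
    unfolding S_def using beta by algebra
  moreover have "jg u w * S\<^sup>2 = ((z - 1)\<^sup>2 * (z + u)\<^sup>2 * K3) * ((z + 1)\<^sup>2 * (z - u)\<^sup>2 * K4)"
    unfolding S_def using gamma by algebra
  ultimately show ?thesis
    using frac[OF F1] frac[OF F2]
    unfolding on_jacobi_def S_def F_def K1_def K2_def K3_def K4_def by simp
qed

text \<open>Squares are 0 or 1 modulo 4 and modulo 3, so \<open>a\<^sup>2 + b\<^sup>2\<close> with
  coprime \<open>a\<close>, \<open>b\<close> is divisible neither by 4 nor by 3.\<close>

lemma no_square_root_minus_one:
  assumes "prime p" "pdiv p m (u\<^sup>2 + 1)" "p = 2 \<and> m = 2 \<or> p = 3 \<and> m = 1"
  shows False
proof -
  obtain a b where q: "quotient_of u = (a, b)" by fastforce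
  have b: "b > 0" using quotient_of_denom_pos[OF q] .
  have cop: "coprime a b" using quotient_of_coprime[OF q] .
  have u: "u = of_int a / of_int b" using quotient_of_div[OF q] .
  have s: "a\<^sup>2 + b\<^sup>2 > 0" using b by (simp add: add_nonneg_pos)
  have eq: "u\<^sup>2 + 1 = of_int (a\<^sup>2 + b\<^sup>2) / of_int (b\<^sup>2)"
    unfolding u using b by (simp add: field_simps)
  have "u\<^sup>2 + 1 \<noteq> 0" unfolding eq using s b by (simp del: of_int_add of_int_power)
  hence "m \<le> pval p (u\<^sup>2 + 1)" using assms by (simp add: pdiv_def)
  also have "\<dots> \<le> int (multiplicity p (a\<^sup>2 + b\<^sup>2))"
    unfolding eq using assms(1) s b by (subst pval_of_int_divide) auto
  finally have "nat m \<le> multiplicity p (a\<^sup>2 + b\<^sup>2)" by simp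
  hence dv: "p ^ nat m dvd a\<^sup>2 + b\<^sup>2" by (rule multiplicity_dvd')
  have "p dvd a \<and> p dvd b"
  proof (cases "p = 2")
    case True
    have sq: "x\<^sup>2 mod 4 = (if even x then 0 else 1)" for x :: int
    proof (cases "even x")
      case True
      then obtain y where "x = 2 * y" by blast
      thus ?thesis by (simp add: power_mult_distrib)
    next
      case False
      then obtain y where "x = 2 * y + 1" by (auto elim: oddE)
      hence "x\<^sup>2 = 1 + 4 * (y\<^sup>2 + y)" by (simp add: power2_eq_square algebra_simps)
      thus ?thesis using False by presburger
    qed
    have "4 dvd a\<^sup>2 + b\<^sup>2" using True dv assms(3) by simp
    hence "even a \<and> even b" using sq[of a] sq[of b] by (simp split: if_splits) presburger+
    thus ?thesis using True by simp
  next
    case False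
    hence p3: "p = 3" "m = 1" using assms(3) by auto
    have sq: "x\<^sup>2 mod 3 = (if 3 dvd x then 0 else 1)" for x :: int
    proof -
      define y where "y = x div 3"
      have "x = 3 * y \<or> x = 3 * y + 1 \<or> x = 3 * y + 2" unfolding y_def by presburger
      then consider "x = 3 * y" | "x = 3 * y + 1" | "x = 3 * y + 2" by blast
      thus ?thesis
      proof cases
        case 1
        hence "x\<^sup>2 = 3 * (3 * y\<^sup>2)" by (simp add: power2_eq_square)
        thus ?thesis using 1 by simp
      next
        case 2
        hence "x\<^sup>2 = 1 + 3 * (3 * y\<^sup>2 + 2 * y)" by (simp add: power2_eq_square algebra_simps)
        moreover have "\<not> 3 dvd x" using 2 by presburger
        ultimately show ?thesis by presburger
      next
        case 3
        hence "x\<^sup>2 = 1 + 3 * (3 * y\<^sup>2 + 4 * y + 1)" by (simp add: power2_eq_square algebra_simps)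
        moreover have "\<not> 3 dvd x" using 3 by presburger
        ultimately show ?thesis by presburger
      qed
    qed
    have "3 dvd a\<^sup>2 + b\<^sup>2" using p3 dv by simp
    hence "3 dvd a \<and> 3 dvd b" using sq[of a] sq[of b] by (simp split: if_splits) presburger+
    thus ?thesis using p3 by simp
  qed
  hence "is_unit p" using cop by (meson coprime_def)
  thus False using assms(1) by auto
qed


section \<open>Infinitely many points from a congruence at a single prime\<close>

lemma pdiv_divide:
  assumes "prime p" "pdiv p k x" "y \<noteq> 0"
  shows "pdiv p (k - pval p y) (x / y)"
  using assms by (cases "x = 0") (auto simp: pdiv_def pval_divide)

lemma pval_2: "prime p \<Longrightarrow> pval p 2 = (if p = 2 then 1 else 0)"
proof -
  assume p: "prime p"
  have v: "pval p 2 = int (multiplicity p 2)" using pval_of_int[OF p, of 2] by simp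
  show ?thesis
  proof (cases "p = 2")
    case True
    thus ?thesis using v p multiplicity_prime[of "2::int"] by auto
  next
    case False
    have "\<not> p dvd 2" using False p primes_dvd_imp_eq[of p 2] by auto
    thus ?thesis using v False by (simp add: not_dvd_imp_multiplicity_0)
  qed
qed

text \<open>Here the point used is not the one of the degenerate triangle but the image of the point at
  infinity of the median curve, translated by the two-torsion point \<open>(0, -1, -1)\<close>.\<close>
lemma jacobi_infinite_two_torsion_shift:
  assumes "prime p" "p \<noteq> 2" "u \<noteq> 0" "w \<noteq> 0"
    and h: "1 \<le> h" "pdiv p h (u\<^sup>2 * w - 1)" "pdiv p (2 * h) (u\<^sup>2 + 1)"
  shows "jacobi_infinite (jb u w) (jg u w)"
proof -
  note p = assms(1)
  define U W where "U = u + 1 / u" and "W = w + 1 / w"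
  have v2: "pval p 2 = 0" using pval_2[OF p] assms(2) by simp
  have v1: "pval p (- 1) = 0" using pval_minus[OF p, of 1] p by simp
  have "pval p (u\<^sup>2) = 0"
    using pval_add_eq(2)[OF p, of "- 1" "u\<^sup>2 + 1"] pdiv_mono[OF h(3), of 1] h(1) v1 by simp
  hence vu: "pval p u = 0" using pval_power[OF p assms(3), of 2] by simp
  have vq: "pval p (u\<^sup>2 * w) = 0"
    using pval_add_eq(2)[OF p, of 1 "u\<^sup>2 * w - 1"] pdiv_mono[OF h(2), of 1] h(1) p by simp
  have vw: "pval p w = 0"
    using vq pval_mult[OF p, of "u\<^sup>2" w] pval_power[OF p assms(3), of 2] vu assms by simp
  have W2: "W + 2 = (w + 1) * (w + 1) / w" unfolding W_def using assms by (simp add: field_simps)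
  \<comment> \<open>\<open>u\<^sup>2 * w\<close> is close to 1 and \<open>u\<^sup>2\<close> to -1,
    so \<open>w\<close> is close to -1. As \<open>W + 2\<close> contains \<open>w + 1\<close>
    squared, it is small to second order.\<close>
  have w1: "pdiv p h (w + 1)"
  proof -
    have "w + 1 = ((u\<^sup>2 * w - 1) + (u\<^sup>2 + 1)) / u\<^sup>2" using assms(3) by (simp add: field_simps)
    moreover have "pdiv p h ((u\<^sup>2 * w - 1) + (u\<^sup>2 + 1))"
      using pdiv_add[OF p h(2) pdiv_mono[OF h(3)]] h(1) by simp
    ultimately show ?thesis
      using pdiv_divide[OF p, of h _ "u\<^sup>2"] assms(3) vu pval_power[OF p assms(3), of 2] by simp
  qed
  have pW2: "pdiv p 2 (W + 2)"
  proof -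
    have "pdiv p (h + h) ((w + 1) * (w + 1))" by (rule pdiv_mult[OF p w1 w1])
    hence "pdiv p (h + h) (W + 2)"
      unfolding W2 using pdiv_divide[OF p _ assms(4)] vw by fastforce
    thus ?thesis by (rule pdiv_mono) (use h in simp)
  qed
  have U: "pdiv p 2 U"
  proof -
    have "U = (u\<^sup>2 + 1) / u" unfolding U_def using assms(3) by (simp add: field_simps power2_eq_square)
    hence "pdiv p (2 * h) U"
      using pdiv_divide[OF p h(3) assms(3)] vu by simp
    thus ?thesis by (rule pdiv_mono) (use h in simp)
  qed
  have vm2: "pval p (- 2) = 0" using v2 pval_minus[OF p, of 2] by simp
  have W0: "W \<noteq> 0" "pval p W = 0"
    using pval_add_eq[OF p, of "- 2" "W + 2"] pdiv_mono[OF pW2, of 1] vm2 by simp_all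
  \<comment> \<open>The signs are chosen so that both are p-adically close to 1, given that
    \<open>W\<close> is close to -2 and \<open>U\<close> to 0.\<close>
  define c d where "c = 2 * (U - 1) / W" and "d = - 2 * (U + 1) / W"
  have "c\<^sup>2 = 1 - jb u w * (1 / W)\<^sup>2" "d\<^sup>2 = 1 - jg u w * (1 / W)\<^sup>2"
    using W0 unfolding c_def d_def jb_def jg_def U_def[symmetric] W_def[symmetric]
    by (simp_all add: field_simps power2_eq_square)
  hence on: "on_jacobi (jb u w) (jg u w) (1 / W, c, d)" by (simp add: on_jacobi_def)
  have U2: "pdiv p 2 (2 * U)" using pdiv_mult_left[OF p pdiv_numeral[OF p] U] .
  have "1 - c = ((W + 2) - 2 * U) / W" "1 - d = ((W + 2) + 2 * U) / W"
    unfolding c_def d_def using W0 by (simp_all add: field_simps)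
  moreover have "pdiv p 2 (x / W)" if "pdiv p 2 x" for x
    using pdiv_divide[OF p that W0(1)] W0(2) by simp
  ultimately have cd: "pdiv p 2 (1 - c)" "pdiv p 2 (1 - d)"
    using pdiv_diff[OF p pW2 U2] pdiv_add[OF p pW2 U2] by auto
  show ?thesis unfolding jacobi_infinite_def
    by (rule jacobi_infinitely_many[OF p on _ cd]) (use W0 in auto)
qed

text \<open>For the point of the degenerate triangle, \<open>1 - c\<close> and \<open>1 - d\<close>
  are \<open>(z - 1)\<^sup>2\<close> times a p-integral number over \<open>jden u z\<close>. By
  \<open>h\<close> the term \<open>2 * (q - 1)\<^sup>2\<close> dominates the bracket in
  \<open>jden\<close>, so the quotients are small unless \<open>p\<close> divides
  \<open>q + 1\<close> to a high power; then another point is used.\<close>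

lemma jacobi_infinite_local_integral:
  assumes p: "prime p" and nz: "u \<noteq> 0" "w \<noteq> 0" "u\<^sup>2 \<noteq> 1" "(u\<^sup>2 * w)\<^sup>2 \<noteq> 1" "(u * w)\<^sup>2 \<noteq> 1"
    and u: "pdiv p 0 u"
    and h: "pval p (u\<^sup>2 * w - 1) \<ge> pval p (u\<^sup>2 - 1) + 1 + pval p 2"
  shows "jacobi_infinite (jb u w) (jg u w)"
proof -
  define z q h k e v2 where "z = u\<^sup>2 * w" and "q = u\<^sup>2" and "h = pval p (u\<^sup>2 * w - 1)"
    and "k = pval p (u\<^sup>2 - 1)" and "e = z\<^sup>2 - 1" and "v2 = pval p 2"
  define i where "i = pval p (q + 1)"
  have v2: "v2 = (if p = 2 then 1 else 0)" unfolding v2_def by (rule pval_2[OF p])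
  have q1: "q - 1 \<noteq> 0" "q + 1 \<noteq> 0" using nz unfolding q_def
    by (auto simp: add_nonneg_eq_0_iff)
  have z0: "z \<noteq> 0" "z - 1 \<noteq> 0" "z + 1 \<noteq> 0" using nz unfolding z_def by (auto simp: power2_eq_1_iff add_eq_0_iff2)
  have int1: "pdiv p 0 (1::rat)" using p by simp
  have q0: "pdiv p 0 q" unfolding q_def using pdiv_power_0[OF p u] .
  have qm: "pdiv p 0 (q - 1)" "pdiv p 0 (q + 1)" using pdiv_diff[OF p q0 int1] pdiv_add[OF p q0 int1] by auto
  have k0: "k \<ge> 0" using qm q1 unfolding pdiv_def k_def q_def by simp
  have i0: "i \<ge> 0" using qm q1 unfolding pdiv_def i_def by simp
  have hk: "h \<ge> k + 1 + v2" using h unfolding h_def k_def v2_def .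
  have hz: "pdiv p h (z - 1)" unfolding pdiv_def h_def z_def by simp
  have z_int: "pdiv p 0 z" using pdiv_add[OF p pdiv_mono[OF hz, of 0] int1] hk k0 v2
    by (auto split: if_splits)
  have e: "pdiv p (h + v2) e"
  proof -
    have "pdiv p v2 2" by (simp add: pdiv_def v2_def)
    hence "pdiv p v2 ((z - 1) + 2)"
      by (intro pdiv_add[OF p pdiv_mono[OF hz]]) (use hk k0 in auto)
    hence "pdiv p v2 (z + 1)" by (simp add: algebra_simps)
    moreover have "e = (z - 1) * (z + 1)" unfolding e_def by (simp add: algebra_simps power2_eq_square)
    ultimately show ?thesis using pdiv_mult[OF p hz] by simp
  qed
  define T where "T = 2 * (q - 1)\<^sup>2 + (q - 1) * (q - 5) * e - (3 * q - 4) * e\<^sup>2"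
  have T: "T \<noteq> 0" "pval p T = v2 + 2 * k"
  proof -
    have 1: "2 * (q - 1)\<^sup>2 \<noteq> 0" "pval p (2 * (q - 1)\<^sup>2) = v2 + 2 * k"
      using q1 by (simp_all add: pval_mult[OF p] pval_power[OF p] k_def v2_def q_def)
    have "pdiv p (k + (h + v2)) ((q - 1) * e)"
      by (rule pdiv_mult[OF p _ e]) (simp add: pdiv_def k_def q_def)
    moreover have "pdiv p 0 (q - 5)" using pdiv_diff[OF p q0 pdiv_numeral[OF p]] .
    ultimately have "pdiv p (k + (h + v2)) ((q - 1) * e * (q - 5))"
      by (rule pdiv_mult_right[OF p])
    hence "pdiv p (v2 + 2 * k + 1) ((q - 1) * e * (q - 5))"
      by (rule pdiv_mono) (use hk v2 in \<open>auto split: if_splits\<close>)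
    hence 2: "pdiv p (v2 + 2 * k + 1) ((q - 1) * (q - 5) * e)" by (simp add: mult_ac)
    have "pdiv p 0 (3 * q - 4)"
      using pdiv_diff[OF p pdiv_mult_left[OF p pdiv_numeral[OF p] q0] pdiv_numeral[OF p]] .
    hence "pdiv p ((h + v2) + (h + v2)) ((3 * q - 4) * (e * e))"
      by (rule pdiv_mult_left[OF p _ pdiv_mult[OF p e e]])
    hence 3: "pdiv p (v2 + 2 * k + 1) ((3 * q - 4) * e\<^sup>2)"
      unfolding power2_eq_square by (rule pdiv_mono) (use hk v2 k0 in \<open>auto split: if_splits\<close>)
    have "T = 2 * (q - 1)\<^sup>2 + ((q - 1) * (q - 5) * e - (3 * q - 4) * e\<^sup>2)" unfolding T_def by simp
    thus "T \<noteq> 0" "pval p T = v2 + 2 * k"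
      using pval_add_eq[OF p 1(1), unfolded 1(2), OF pdiv_diff[OF p 2 3]] by auto
  qed
  define F where "F = jden u z"
  have F_eq: "F = (q + 1) * T + e ^ 3" unfolding F_def jden_def T_def e_def q_def ..
  have e3: "pdiv p (3 * (h + v2)) (e ^ 3)"
    using pdiv_mult[OF p e pdiv_mult[OF p e e]] by (simp add: power3_eq_cube mult.assoc)
  have vqT: "(q + 1) * T \<noteq> 0" "pval p ((q + 1) * T) = i + (v2 + 2 * k)"
    using q1 T by (auto simp: pval_mult[OF p] i_def)
  \<comment> \<open>The first condition makes \<open>(q + 1) * T\<close> dominate
    \<open>e ^ 3\<close>. The second says that \<open>p ^ m\<close> still divides
    \<open>1 - c\<close> and \<open>1 - d\<close> after division by \<open>F\<close>.\<close>
  have main: ?thesis if i: "i + v2 + 2 * k + 1 \<le> 3 * (h + v2)"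
    and m: "m = 2 \<or> m = 1 \<and> p \<ge> 5" "m \<le> 2 * h - (i + v2 + 2 * k)" for m
  proof -
    have F: "F \<noteq> 0" "pval p F = i + v2 + 2 * k"
      unfolding F_eq using pval_add_eq[OF p vqT(1), unfolded vqT(2), OF pdiv_mono[OF e3]] i by auto
    have small: "pdiv p m ((z - 1)\<^sup>2 * x / F)" if "pdiv p 0 x" for x
    proof -
      have "pdiv p (h + h) ((z - 1)\<^sup>2 * x)"
        unfolding power2_eq_square by (rule pdiv_mult_right[OF p pdiv_mult[OF p hz hz] that])
      hence "pdiv p (h + h - pval p F) ((z - 1)\<^sup>2 * x / F)"
        by (rule pdiv_divide[OF p _ F(1)])
      thus ?thesis by (rule pdiv_mono) (use m F in auto)
    qed
    have on: "on_jacobi (jb u w) (jg u w)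
      ((z\<^sup>2 - 1) * (z\<^sup>2 - u\<^sup>2) * u\<^sup>2 * z / F,
       1 - (z - 1)\<^sup>2 * (z - u)\<^sup>2 * (z\<^sup>2 + u ^ 4 + 2 * u * z * (u\<^sup>2 + 1) - 2 * u\<^sup>2 * z) / F,
       1 - (z - 1)\<^sup>2 * (z + u)\<^sup>2 * (z\<^sup>2 + u ^ 4 - 2 * u * z * (u\<^sup>2 + 1) - 2 * u\<^sup>2 * z) / F)"
      unfolding F_def by (rule on_jacobi_degenerate_triangle) (use nz z0 F F_def z_def in auto)
    have "z\<^sup>2 - u\<^sup>2 = u\<^sup>2 * ((u * w)\<^sup>2 - 1)" unfolding z_def by (simp add: algebra_simps power2_eq_square)
    hence "z\<^sup>2 - u\<^sup>2 \<noteq> 0" using nz by simp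
    moreover have "z\<^sup>2 - 1 \<noteq> 0" using nz z_def by simp
    ultimately have s: "(z\<^sup>2 - 1) * (z\<^sup>2 - u\<^sup>2) * u\<^sup>2 * z / F \<noteq> 0" using nz z0 F by simp
    note cl = pdiv_add[OF p] pdiv_diff[OF p] pdiv_mult_left[OF p] pdiv_power_0[OF p] u z_int int1 pdiv_numeral[OF p]
    show ?thesis unfolding jacobi_infinite_def
      by (rule jacobi_infinitely_many[OF p on s _ _ m(1)])
         (simp only: diff_diff_eq2 add_diff_cancel_left' mult.assoc, rule small, intro cl)+
  qed
  show ?thesis
  proof (cases "p = 2")
    case True
    have "i < 2"
    proof (rule ccontr)
      assume "\<not> i < 2"
      hence "pdiv p 2 (u\<^sup>2 + 1)" unfolding pdiv_def i_def q_def by simp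
      thus False using no_square_root_minus_one[OF p] True by blast
    qed
    thus ?thesis using main[of 2] hk v2 True k0 i0 by simp
  next
    case p2: False
    hence v20: "v2 = 0" using v2 by simp
    show ?thesis
    proof (cases "i = 0")
      case True
      thus ?thesis using main[of 2] hk v20 k0 by simp
    next
      case False
      \<comment> \<open>Here -1 is a square modulo \<open>p\<close>, which excludes 3 and leaves
        \<open>p \<ge> 5\<close>. As \<open>q + 1\<close> and \<open>q - 1\<close> differ by 2,
        \<open>p\<close> does not divide \<open>q - 1\<close>.\<close>
      hence i1: "i \<ge> 1" using i0 by simp
      have iq: "pdiv p i (q + 1)" by (simp add: pdiv_def i_def)
      have "p \<noteq> 3"
        using no_square_root_minus_one[OF p, of 1 u] pdiv_mono[OF iq, of 1] i1 unfolding q_def by auto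
      moreover have "p \<noteq> 4" using p by (auto simp: prime_int_iff dest: spec[of _ 2])
      moreover have "p \<ge> 2" using p by (simp add: prime_ge_2_int)
      ultimately have p5: "p \<ge> 5" using p2 by linarith
      have "pval p (- 2) = 0" using pval_minus[OF p, of 2] v20 v2_def by simp
      hence k: "k = 0"
        using pval_add_eq(2)[OF p, of "- 2" "q + 1"] pdiv_mono[OF iq, of 1] i1
        unfolding k_def q_def by simp
      show ?thesis
      \<comment> \<open>If \<open>i < 2 * h\<close>, one factor \<open>p\<close> of
        \<open>(z - 1)\<^sup>2\<close> survives the division, which suffices for
        \<open>p \<ge> 5\<close>. Otherwise \<open>q + 1\<close> is small enough for the shifted
        point at infinity.\<close>
      proof (cases "i < 2 * h")
        case True
        thus ?thesis using main[of 1] p5 v20 k hk by simp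
      next
        case False
        show ?thesis
        proof (rule jacobi_infinite_two_torsion_shift[OF p p2 nz(1,2)])
          show "1 \<le> h" using hk k v20 by simp
          show "pdiv p h (u\<^sup>2 * w - 1)" using hz unfolding z_def .
          show "pdiv p (2 * h) (u\<^sup>2 + 1)" using pdiv_mono[OF iq] False unfolding q_def by simp
        qed
      qed
    qed
  qed
qed

subsection \<open>A height argument\<close>


text \<open>Allows passing to \<open>1 / u\<close> when \<open>p\<close> divides the denominator of
  \<open>u\<close>.\<close>

lemma jb_inverse: "u \<noteq> 0 \<Longrightarrow> w \<noteq> 0 \<Longrightarrow> jb (1 / u) (1 / w) = jb u w"
  and jg_inverse: "u \<noteq> 0 \<Longrightarrow> w \<noteq> 0 \<Longrightarrow> jg (1 / u) (1 / w) = jg u w"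
  by (simp_all add: jb_def jg_def add.commute)

text \<open>Transfers the local criterion from \<open>u\<^sup>2 * w\<close> to
  \<open>u\<^sup>2 / w\<close>.\<close>

lemma jb_inverse_right: "w \<noteq> 0 \<Longrightarrow> jb u (1 / w) = jb u w"
  and jg_inverse_right: "w \<noteq> 0 \<Longrightarrow> jg u (1 / w) = jg u w"
  by (simp_all add: jb_def jg_def add.commute)

text \<open>Transfers the local criterion from \<open>u\<^sup>2 * w - 1\<close> to
  \<open>u\<^sup>2 * w + 1\<close>.\<close>

lemma jb_minus_right: "jb u (- w) = jb u w"
  and jg_minus_right: "jg u (- w) = jg u w"
proof -
  have "(- w + 1 / - w)\<^sup>2 = (w + 1 / w)\<^sup>2" for w :: 'a
    by (metis add.inverse_distrib_swap add.commute divide_minus_right power2_minus)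
  thus "jb u (- w) = jb u w" "jg u (- w) = jg u w" by (simp_all only: jb_def jg_def)
qed

text \<open>If \<open>u\<close> is not p-integral, invert \<open>u\<close> and \<open>w\<close>.
  With \<open>z = u\<^sup>2 * w\<close>, a p-adic unit, \<open>z - 1\<close> becomes
  \<open>- (z - 1) / z\<close> of the same valuation, and \<open>1 / u\<^sup>2 - 1\<close> is a
  unit.\<close>

lemma jacobi_infinite_local:
  assumes p: "prime p" and nz: "u \<noteq> 0" "w \<noteq> 0" "u\<^sup>2 \<noteq> 1" "(u\<^sup>2 * w)\<^sup>2 \<noteq> 1" "(u * w)\<^sup>2 \<noteq> 1"
    and h: "pval p (u\<^sup>2 * w - 1) \<ge> max 0 (pval p (u\<^sup>2 - 1)) + 1 + pval p 2"
  shows "jacobi_infinite (jb u w) (jg u w)"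
proof (cases "pval p u \<ge> 0")
  case True
  thus ?thesis using h by (intro jacobi_infinite_local_integral[OF p nz]) (auto simp: pdiv_def)
next
  case False
  define u' w' where "u' = 1 / u" and "w' = 1 / w"
  have vu': "pval p u' \<ge> 1" unfolding u'_def using False pval_divide[OF p, of 1 u] nz p by simp
  have nz': "u' \<noteq> 0" "w' \<noteq> 0" "u'\<^sup>2 \<noteq> 1" "(u'\<^sup>2 * w')\<^sup>2 \<noteq> 1" "(u' * w')\<^sup>2 \<noteq> 1"
    using nz unfolding u'_def w'_def by (auto simp: power_divide field_simps)
  have v2: "pval p 2 \<ge> 0" using pval_2[OF p] by simp
  have hz: "pdiv p 1 (u\<^sup>2 * w - 1)" using h v2 by (auto simp: pdiv_def)
  have vz: "pval p (u\<^sup>2 * w) = 0"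
    using pval_add_eq(2)[OF p, of 1 "u\<^sup>2 * w - 1"] hz p by simp
  have "u'\<^sup>2 * w' - 1 = - (u\<^sup>2 * w - 1) / (u\<^sup>2 * w)"
    unfolding u'_def w'_def using nz by (simp add: field_simps)
  moreover have "u\<^sup>2 * w - 1 \<noteq> 0" using nz(4) by auto
  ultimately have vz': "pval p (u'\<^sup>2 * w' - 1) = pval p (u\<^sup>2 * w - 1)"
    using vz nz pval_divide[OF p, of "- (u\<^sup>2 * w - 1)" "u\<^sup>2 * w"] pval_minus[OF p, of "u\<^sup>2 * w - 1"] by simp
  have "pdiv p 1 (u'\<^sup>2)" using vu' nz' by (simp add: pdiv_def pval_power[OF p])
  hence vu2: "pval p (u'\<^sup>2 - 1) = 0"
    using pval_add_eq(2)[OF p, of "- 1" "u'\<^sup>2"] pval_minus[OF p, of 1] p by simp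
  have "jacobi_infinite (jb u' w') (jg u' w')"
    using h vz' vu2 vu' by (intro jacobi_infinite_local_integral[OF p nz']) (auto simp: pdiv_def)
  thus ?thesis unfolding u'_def w'_def using nz by (simp add: jb_inverse jg_inverse)
qed

text \<open>The local criterion read backwards, in integers. If \<open>p\<close> divides
  \<open>r - s\<close>, coprimality keeps \<open>p\<close> out of \<open>s\<close>, so the
  multiplicity of \<open>r - s\<close> is the valuation of \<open>u\<^sup>2 * w - 1\<close>.\<close>

lemma multiplicity_le_if_not_jacobi_infinite:
  fixes a b r s :: int
  assumes p: "prime p" and not: "\<not> jacobi_infinite (jb u w) (jg u w)"
    and nz: "u \<noteq> 0" "w \<noteq> 0" "u\<^sup>2 \<noteq> 1" "(u\<^sup>2 * w)\<^sup>2 \<noteq> 1" "(u * w)\<^sup>2 \<noteq> 1"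
    and ab: "u = of_int a / of_int b" "b \<noteq> 0" and rs: "u\<^sup>2 * w = of_int r / of_int s" "s \<noteq> 0" "coprime r s"
  shows "multiplicity p (r - s) \<le> multiplicity p (a\<^sup>2 - b\<^sup>2) + (if p = 2 then 1 else 0)"
proof (cases "p dvd r - s")
  case False
  thus ?thesis by (simp add: not_dvd_imp_multiplicity_0)
next
  case True
  have ps: "\<not> p dvd s"
  proof
    assume "p dvd s"
    moreover from this have "p dvd r" using True by (metis dvd_add_right_iff diff_add_cancel add.commute)
    ultimately have "is_unit p" using rs(3) by (meson coprime_def)
    thus False using p by auto
  qed
  have "u\<^sup>2 * w - 1 \<noteq> 0" using nz(4) by auto
  hence rs0: "r - s \<noteq> 0" using rs by auto
  have "u\<^sup>2 * w - 1 = of_int (r - s) / of_int s" using rs by (simp add: field_simps)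
  hence vz: "pval p (u\<^sup>2 * w - 1) = int (multiplicity p (r - s))"
    using pval_of_int_divide[OF p rs0 rs(2)] ps by (simp add: not_dvd_imp_multiplicity_0)
  have eq: "u\<^sup>2 - 1 = of_int (a\<^sup>2 - b\<^sup>2) / of_int (b\<^sup>2)" unfolding ab(1) using ab(2) by (simp add: field_simps)
  have "u\<^sup>2 - 1 \<noteq> 0" using nz(3) by simp
  hence "a\<^sup>2 - b\<^sup>2 \<noteq> 0" unfolding eq by (metis div_0 of_int_0)
  hence vu: "pval p (u\<^sup>2 - 1) \<le> int (multiplicity p (a\<^sup>2 - b\<^sup>2))"
    unfolding eq using ab(2) by (subst pval_of_int_divide[OF p]) auto
  have "\<not> pval p (u\<^sup>2 * w - 1) \<ge> max 0 (pval p (u\<^sup>2 - 1)) + 1 + pval p 2"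
    using not jacobi_infinite_local[OF p nz] by blast
  thus ?thesis using vz vu pval_2[OF p] by (auto split: if_splits)
qed

text \<open>Compare multiplicities prime by prime. A common prime of \<open>r - s\<close> and
  \<open>r + s\<close> can only be 2, and it divides one of them just once; the factor 4 absorbs
  this and the loss at 2 in the local bound.\<close>

lemma dvd_if_not_jacobi_infinite:
  fixes a b r s :: int
  assumes not: "\<not> jacobi_infinite (jb u w) (jg u w)"
    and nz: "u \<noteq> 0" "w \<noteq> 0" "u\<^sup>2 \<noteq> 1" "(u\<^sup>2 * w)\<^sup>2 \<noteq> 1" "(u * w)\<^sup>2 \<noteq> 1"
    and ab: "u = of_int a / of_int b" "b \<noteq> 0" and rs: "u\<^sup>2 * w = of_int r / of_int s" "s \<noteq> 0" "coprime r s"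
  shows "(r - s) * (r + s) dvd 4 * (a\<^sup>2 - b\<^sup>2)"
proof (rule multiplicity_le_imp_dvd)
  have sq: "(u\<^sup>2 * w)\<^sup>2 - 1 \<noteq> 0" using nz(4) by simp
  have "(u\<^sup>2 * w)\<^sup>2 - 1 = of_int ((r - s) * (r + s)) / of_int (s\<^sup>2)"
    unfolding rs(1) using rs(2) by (simp add: field_simps power2_eq_square)
  with sq have nz_rs: "(r - s) * (r + s) \<noteq> 0" by (metis div_0 of_int_0)
  thus "(r - s) * (r + s) \<noteq> 0" .
  have "u\<^sup>2 - 1 = of_int (a\<^sup>2 - b\<^sup>2) / of_int (b\<^sup>2)" unfolding ab(1) using ab(2) by (simp add: field_simps)
  moreover have "u\<^sup>2 - 1 \<noteq> 0" using nz(3) by simp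
  ultimately have nz_ab: "a\<^sup>2 - b\<^sup>2 \<noteq> 0" by (metis div_0 of_int_0)
  fix p :: int assume p: "prime p"
  let ?e = "if p = 2 then 1 else 0 :: nat"
  have 1: "multiplicity p (r - s) \<le> multiplicity p (a\<^sup>2 - b\<^sup>2) + ?e"
    by (rule multiplicity_le_if_not_jacobi_infinite[OF p not nz ab rs])
  have "multiplicity p (- r - s) \<le> multiplicity p (a\<^sup>2 - b\<^sup>2) + ?e"
    by (rule multiplicity_le_if_not_jacobi_infinite[OF p, of u "- w"])
       (use not nz ab rs in \<open>auto simp: jb_minus_right jg_minus_right\<close>)
  moreover have "multiplicity p (- r - s) = multiplicity p (r + s)"
    using multiplicity_normalize_right[of p "- r - s"] multiplicity_normalize_right[of p "r + s"]
    by (simp add: abs_minus_commute) (metis abs_minus_cancel minus_add_distrib uminus_add_conv_diff add.commute)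
  ultimately have 2: "multiplicity p (r + s) \<le> multiplicity p (a\<^sup>2 - b\<^sup>2) + ?e" by simp
  have 3: "multiplicity p (r - s) \<le> ?e \<or> multiplicity p (r + s) \<le> ?e"
  proof (rule ccontr)
    assume "\<not> ?thesis"
    hence "Suc ?e \<le> multiplicity p (r - s)" "Suc ?e \<le> multiplicity p (r + s)" by linarith+
    hence "p ^ Suc ?e dvd r - s" "p ^ Suc ?e dvd r + s"
      using multiplicity_dvd' by blast+
    hence "p ^ Suc ?e dvd (r + s) + (r - s)" "p ^ Suc ?e dvd (r + s) - (r - s)"
      using dvd_add dvd_diff by blast+
    hence d: "p ^ Suc ?e dvd 2 * r" "p ^ Suc ?e dvd 2 * s" by simp_all
    have "p dvd r \<and> p dvd s"
    proof (cases "p = 2")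
      case True
      thus ?thesis using d by (auto simp: power2_eq_square)
    next
      case False
      hence "p dvd 2 * r" "p dvd 2 * s" using d by simp_all
      moreover have "\<not> p dvd 2" using False p primes_dvd_imp_eq[of p 2] by auto
      ultimately show ?thesis using prime_dvd_multD[OF p] by blast
    qed
    hence "is_unit p" using rs(3) by (meson coprime_def)
    thus False using p by auto
  qed
  have "multiplicity p (4 :: int) = 2 * ?e"
  proof (cases "p = 2")
    case True
    have "multiplicity (2 :: int) (2 ^ 2) = 2" by (rule multiplicity_prime_power) simp
    thus ?thesis using True by simp
  next
    case False
    have "\<not> p dvd 2" using False p primes_dvd_imp_eq[of p 2] by auto
    hence "\<not> p dvd 2 * 2" using prime_dvd_multD[OF p] by blast
    thus ?thesis using False by (simp add: not_dvd_imp_multiplicity_0)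
  qed
  hence "multiplicity p (4 * (a\<^sup>2 - b\<^sup>2)) = 2 * ?e + multiplicity p (a\<^sup>2 - b\<^sup>2)"
    using prime_multiplicity_mult[OF p, of 4 "a\<^sup>2 - b\<^sup>2"] nz_ab by simp
  moreover have "multiplicity p ((r - s) * (r + s)) = multiplicity p (r - s) + multiplicity p (r + s)"
    using nz_rs by (intro prime_multiplicity_mult[OF p]) auto
  ultimately show "multiplicity p ((r - s) * (r + s)) \<le> multiplicity p (4 * (a\<^sup>2 - b\<^sup>2))"
    using 1 2 3 by (auto split: if_splits)
qed

text \<open>For \<open>u = a / b\<close> with \<open>a > 8\<close> the numbers \<open>u\<^sup>2w\<close> and \<open>u\<^sup>2/w\<close> cannot both have the small height
  that divisibility forces on them, because their product is \<open>u\<^sup>4\<close>.\<close>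
lemma jacobi_infinite_if_large_numerator:
  assumes u: "u > 1" and w: "w > 1" and ne: "u \<noteq> w" "u\<^sup>2 \<noteq> w" and num: "fst (quotient_of u) > 8"
  shows "jacobi_infinite (jb u w) (jg u w)"
proof (rule ccontr)
  assume not: "\<not> jacobi_infinite (jb u w) (jg u w)"
  obtain a b where q: "quotient_of u = (a, b)" by fastforce
  have a8: "a > 8" using num q by simp
  have b: "b > 0" using quotient_of_denom_pos[OF q] .
  have cop: "coprime a b" using quotient_of_coprime[OF q] .
  have ua: "u = of_int a / of_int b" using quotient_of_div[OF q] .
  have ab: "a > b" using u b unfolding ua by simp
  have pos: "a\<^sup>2 - b\<^sup>2 > 0" using ab b by (simp add: power_strict_mono)
  have u2: "u\<^sup>2 > 1" using u by (simp add: one_less_power)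
  have z1: "u\<^sup>2 * w > 1" using u2 w by (simp add: less_1_mult)
  have uw1: "u * w > 1" using u w by (simp add: less_1_mult)
  obtain r s where rs: "quotient_of (u\<^sup>2 * w) = (r, s)" by fastforce
  note rs' = quotient_of_div[OF rs] quotient_of_denom_pos[OF rs] quotient_of_coprime[OF rs]
  have "(r - s) * (r + s) dvd 4 * (a\<^sup>2 - b\<^sup>2)"
  proof (rule dvd_if_not_jacobi_infinite[OF not _ _ _ _ _ ua _ rs'(1) _ rs'(3)])
    show "u \<noteq> 0" "w \<noteq> 0" "u\<^sup>2 \<noteq> 1" "b \<noteq> 0" "s \<noteq> 0"
      using u w less_imp_neq[OF u2] b rs'(2) by auto
    show "(u\<^sup>2 * w)\<^sup>2 \<noteq> 1" using one_less_power[OF z1, of 2] by simp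
    show "(u * w)\<^sup>2 \<noteq> 1" using one_less_power[OF uw1, of 2] by simp
  qed
  hence le1: "r\<^sup>2 - s\<^sup>2 \<le> 4 * (a\<^sup>2 - b\<^sup>2)"
    using pos by (intro zdvd_imp_le) (auto simp: algebra_simps power2_eq_square)
  \<comment> \<open>\<open>u \<le> u\<^sup>2 * w\<close> gives \<open>a * s \<le> r * b\<close>,
    hence \<open>r\<^sup>2 * (a\<^sup>2 - b\<^sup>2) \<le> a\<^sup>2 * (r\<^sup>2 -
    s\<^sup>2)\<close>, and the divisibility bounds the right side by
    \<open>4 * a\<^sup>2 * (a\<^sup>2 - b\<^sup>2)\<close>.\<close>
  have r: "r \<le> 2 * a"
  proof (rule ccontr)
    assume "\<not> r \<le> 2 * a"
    hence r2: "r > 2 * a" by simp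
    have "u * 1 \<le> u * (u * w)" using u uw1 by (intro mult_left_mono) auto
    hence "u \<le> u\<^sup>2 * w" by (simp add: power2_eq_square mult.assoc)
    hence "of_int a / of_int b \<le> (of_int r / of_int s :: rat)" using ua rs'(1) by simp
    hence "(of_int (a * s) :: rat) \<le> of_int (r * b)" using b rs'(2) by (simp add: field_simps)
    hence "a * s \<le> r * b" by linarith
    hence "(a * s)\<^sup>2 \<le> (r * b)\<^sup>2" using a8 rs'(2) by (intro power_mono) auto
    hence A: "a\<^sup>2 * s\<^sup>2 \<le> r\<^sup>2 * b\<^sup>2" by (simp add: power_mult_distrib)
    have "(2 * a)\<^sup>2 < r\<^sup>2" using r2 a8 by (intro power_strict_mono) auto
    hence "4 * a\<^sup>2 < r\<^sup>2" by simp
    hence B: "4 * a\<^sup>2 * (a\<^sup>2 - b\<^sup>2) < r\<^sup>2 * (a\<^sup>2 - b\<^sup>2)" using pos by simp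
    have "a\<^sup>2 * (r\<^sup>2 - s\<^sup>2) \<le> a\<^sup>2 * (4 * (a\<^sup>2 - b\<^sup>2))" using le1 by (intro mult_left_mono) auto
    thus False using A B by (simp add: algebra_simps)
  qed
  define w' where "w' = 1 / w"
  have not': "\<not> jacobi_infinite (jb u w') (jg u w')"
    unfolding w'_def using not w by (simp add: jb_inverse_right jg_inverse_right)
  have w'0: "w' > 0" unfolding w'_def using w by simp
  obtain r' s' where rs2: "quotient_of (u\<^sup>2 * w') = (r', s')" by fastforce
  note rs2' = quotient_of_div[OF rs2] quotient_of_denom_pos[OF rs2] quotient_of_coprime[OF rs2]
  have z'0: "u\<^sup>2 * w' > 0" using u w'0 by simp
  \<comment> \<open>The excluded cases are those in which the point attached to
    \<open>u\<^sup>2 / w\<close> has first coordinate 0.\<close>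
  have ne': "u\<^sup>2 * w' \<noteq> 1" "u * w' \<noteq> 1" using ne w unfolding w'_def by auto
  have neg: "u\<^sup>2 * w' \<noteq> - 1" "u * w' \<noteq> - 1" using z'0 mult_pos_pos[OF _ w'0, of u] u by linarith+
  have r'0: "r' > 0" using z'0 rs2' by (simp add: zero_less_divide_iff)
  have dv': "(r' - s') * (r' + s') dvd 4 * (a\<^sup>2 - b\<^sup>2)"
  proof (rule dvd_if_not_jacobi_infinite[OF not' _ _ _ _ _ ua _ rs2'(1) _ rs2'(3)])
    show "u \<noteq> 0" "w' \<noteq> 0" "u\<^sup>2 \<noteq> 1" "b \<noteq> 0" "s' \<noteq> 0"
      using u w'0 less_imp_neq[OF u2] b rs2'(2) by auto
    show "(u\<^sup>2 * w')\<^sup>2 \<noteq> 1" "(u * w')\<^sup>2 \<noteq> 1" using ne' neg unfolding power2_eq_1_iff by blast+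
  qed
  have "r' + s' dvd 4 * (a\<^sup>2 - b\<^sup>2)" using dv' dvd_mult_right by blast
  hence "r' + s' \<le> 4 * (a\<^sup>2 - b\<^sup>2)" using pos by (intro zdvd_imp_le) auto
  hence r': "r' \<le> 4 * a\<^sup>2" using rs2'(2) b by (simp add: algebra_simps) (smt (verit) zero_le_power2)
  \<comment> \<open>The two fractions multiply to \<open>u ^ 4\<close>. Since \<open>a\<close> is
    coprime to \<open>b\<close>, \<open>a ^ 4\<close> divides \<open>r * r'\<close>, which is at
    most \<open>(2 * a) * (4 * a\<^sup>2)\<close>.\<close>
  have "(of_int a / of_int b) ^ 4 = (of_int r / of_int s) * (of_int r' / of_int s' :: rat)"
    unfolding ua[symmetric] rs'(1)[symmetric] rs2'(1)[symmetric] w'_def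
    using w by (simp add: power4_eq_xxxx power2_eq_square)
  hence "(of_int (a ^ 4 * (s * s')) :: rat) = of_int (b ^ 4 * (r * r'))"
    using b rs'(2) rs2'(2) by (simp add: field_simps)
  hence "a ^ 4 * (s * s') = b ^ 4 * (r * r')" by linarith
  hence "a ^ 4 dvd b ^ 4 * (r * r')" by (metis dvd_triv_left)
  hence "a ^ 4 dvd r * r'" using cop by (simp add: coprime_dvd_mult_right_iff)
  moreover have "(of_int r / of_int s :: rat) > 0" using z1 rs'(1) by simp
  hence "r > 0" using rs'(2) by (simp add: zero_less_divide_iff)
  ultimately have "a ^ 4 \<le> r * r'" using r'0 by (intro zdvd_imp_le) auto
  also have "\<dots> \<le> (2 * a) * (4 * a\<^sup>2)" using r r' r'0 a8 by (intro mult_mono) auto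
  also have "\<dots> = 8 * a ^ 3" by (simp add: power2_eq_square power3_eq_cube)
  finally have "a * a ^ 3 \<le> 8 * a ^ 3" by (simp add: power4_eq_xxxx power3_eq_cube mult_ac)
  moreover have "a ^ 3 > 0" using a8 by simp
  ultimately have "a \<le> 8" by (simp only: mult_le_cancel_right)
  thus False using a8 by simp
qed

subsection \<open>Rational points close to the identity\<close>


text \<open>\<open>b * s\<^sup>2 = 1 - c\<^sup>2\<close> is at most 1, and \<open>g < b\<close>
  makes the other factor of the product smaller than 1. So addition is defined for all real
  points.\<close>

lemma jacobi_denominator_pos:
  fixes b g :: real
  assumes "b > 0" "g < b" "on_jacobi b g (s1, c1, d1)" "on_jacobi b g (s2, c2, d2)"
  shows "1 - b * g * s1\<^sup>2 * s2\<^sup>2 > 0"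
proof -
  have 1: "b * s1\<^sup>2 \<le> 1" "b * s2\<^sup>2 \<le> 1"
    using assms(3,4) zero_le_power2[of c1] zero_le_power2[of c2] by (auto simp: on_jacobi_def)
  have eq: "b * g * s1\<^sup>2 * s2\<^sup>2 = (b * s1\<^sup>2) * (g * s2\<^sup>2)" by simp
  show ?thesis
  proof (cases "g \<le> 0 \<or> s2 = 0")
    case True
    hence "g * s2\<^sup>2 \<le> 0" by (auto simp: mult_nonpos_nonneg)
    from mult_nonneg_nonpos[OF _ this, of "b * s1\<^sup>2"]
    have "(b * s1\<^sup>2) * (g * s2\<^sup>2) \<le> 0" using assms(1) by simp
    thus ?thesis unfolding eq by simp
  next
    case False
    hence "g * s2\<^sup>2 < b * s2\<^sup>2" using assms(2) by simp
    moreover have "(b * s1\<^sup>2) * (g * s2\<^sup>2) \<le> 1 * (g * s2\<^sup>2)"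
      using 1 False by (intro mult_right_mono) auto
    ultimately show ?thesis unfolding eq using 1 by linarith
  qed
qed

lemma on_jacobi_neg: "on_jacobi b g (s, c, d) \<Longrightarrow> on_jacobi b g (- s, c, d)"
  by (simp add: on_jacobi_def)

lemma on_jacobi_of_rat:
  "on_jacobi (of_rat b) (of_rat g) (of_rat s, of_rat c, of_rat d :: real) \<longleftrightarrow> on_jacobi b g (s, c, d)"
proof -
  have "((of_rat c)\<^sup>2 = 1 - of_rat b * (of_rat s :: real)\<^sup>2) = (c\<^sup>2 = 1 - b * s\<^sup>2)" for b c s
    using of_rat_eq_iff[where 'a = real, of "c\<^sup>2" "1 - b * s\<^sup>2"]
    by (simp add: of_rat_diff of_rat_mult of_rat_power)
  thus ?thesis by (simp add: on_jacobi_def)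
qed

text \<open>Jacobi's imaginary transformation; for \<open>b < 0\<close> it leads to a curve on which the addition law
  has no exceptional real points.\<close>
lemma on_jacobi_imaginary:
  fixes b g :: "'a::field"
  assumes "on_jacobi b g (s, c, d)" "c \<noteq> 0"
  shows "on_jacobi (- b) (g - b) (s / c, 1 / c, d / c)"
proof -
  have "c\<^sup>2 = 1 - b * s\<^sup>2" "d\<^sup>2 = 1 - g * s\<^sup>2" using assms by (auto simp: on_jacobi_def)
  hence "1 = c\<^sup>2 + b * s\<^sup>2" "d\<^sup>2 = c\<^sup>2 - (g - b) * s\<^sup>2" by (auto simp: algebra_simps)
  thus ?thesis using assms(2)
    by (simp add: on_jacobi_def power_divide divide_simps)
qed

lemma abs_le_if_power2_le: "\<bar>x\<bar> \<le> K + 1" if "x\<^sup>2 \<le> K" for x K :: real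
proof (cases "\<bar>x\<bar> \<le> 1")
  case True
  thus ?thesis using that zero_le_power2[of x] by linarith
next
  case False
  hence "\<bar>x\<bar> * 1 \<le> \<bar>x\<bar> * \<bar>x\<bar>" by (intro mult_left_mono) auto
  thus ?thesis using that by (simp add: power2_eq_square)
qed

text \<open>For \<open>b > 0\<close> the real curve is bounded, so some subsequence of the rational
  points converges. Differences of its consecutive terms are rational points that tend to the
  identity.\<close>

lemma jacobi_small_points_pos:
  fixes b g :: rat
  assumes b: "b > 0" and g: "g < b" and inf: "jacobi_infinite b g"
  shows "\<exists>s c d :: nat \<Rightarrow> rat. (\<forall>n. on_jacobi b g (s n, c n, d n) \<and> s n < 0) \<and>
    (\<lambda>n. real_of_rat (s n)) \<longlonglongrightarrow> 0 \<and> (\<lambda>n. real_of_rat (c n)) \<longlonglongrightarrow> 1 \<and> (\<lambda>n. real_of_rat (d n)) \<longlonglongrightarrow> 1"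
proof -
  obtain f :: "nat \<Rightarrow> rat \<times> rat \<times> rat" where f: "\<And>n. on_jacobi b g (f n)" and inj: "inj (\<lambda>n. (fst (f n))\<^sup>2)"
    using inf unfolding jacobi_infinite_def by blast
  define s c d where "s n = fst (f n)" and "c n = fst (snd (f n))" and "d n = snd (snd (f n))" for n
  have on: "on_jacobi b g (s n, c n, d n)" for n using f[of n] by (simp add: s_def c_def d_def)
  define B G where "B = real_of_rat b" and "G = real_of_rat g"
  have BG: "B > 0" "G < B" using b g by (auto simp: B_def G_def of_rat_less)
  define s' c' d' where "s' n = real_of_rat (s n)" and "c' n = real_of_rat (c n)"
    and "d' n = real_of_rat (d n)" for n
  have on': "on_jacobi B G (s' n, c' n, d' n)" for n
    unfolding B_def G_def s'_def c'_def d'_def using on on_jacobi_of_rat by blast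
  have eqs: "(c' n)\<^sup>2 = 1 - B * (s' n)\<^sup>2" "(d' n)\<^sup>2 = 1 - G * (s' n)\<^sup>2" for n
    using on'[of n] by (auto simp: on_jacobi_def)
  have "B * (s' n)\<^sup>2 \<le> 1" for n using eqs(1)[of n] zero_le_power2[of "c' n"] by linarith
  hence s_bd: "(s' n)\<^sup>2 \<le> 1 / B" for n using BG by (simp add: pos_le_divide_eq mult.commute)
  have c_bd: "(c' n)\<^sup>2 \<le> 1" for n using eqs(1)[of n] BG by simp
  have d_bd: "(d' n)\<^sup>2 \<le> 1 + \<bar>G\<bar> * (1 / B)" for n
  proof -
    have "- G * (s' n)\<^sup>2 \<le> \<bar>G\<bar> * (s' n)\<^sup>2" by (intro mult_right_mono) auto
    also have "\<dots> \<le> \<bar>G\<bar> * (1 / B)" using s_bd by (intro mult_left_mono) auto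
    finally show ?thesis using eqs(2)[of n] by simp
  qed
  define K where "K = 1 / B + 1 + (1 + 1) + (1 + \<bar>G\<bar> * (1 / B) + 1)"
  have "0 \<le> 1 / B" "0 \<le> \<bar>G\<bar> * (1 / B)" using BG by auto
  hence "\<bar>s' n\<bar> \<le> K \<and> \<bar>c' n\<bar> \<le> K \<and> \<bar>d' n\<bar> \<le> K" for n
    using abs_le_if_power2_le[OF s_bd[of n]] abs_le_if_power2_le[OF c_bd[of n]]
      abs_le_if_power2_le[OF d_bd[of n]] unfolding K_def by linarith
  hence sub: "range (\<lambda>n. (s' n, c' n, d' n)) \<subseteq> {-K..K} \<times> {-K..K} \<times> {-K..K}"
    by (auto simp: abs_le_iff) (metis abs_le_iff minus_le_iff)+
  have "bounded ({-K..K} \<times> {-K..K} \<times> {-K..K})" by (intro bounded_Times bounded_closed_interval)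
  hence "bounded (range (\<lambda>n. (s' n, c' n, d' n)))" using sub bounded_subset by blast
  then obtain l r where r: "strict_mono (r :: nat \<Rightarrow> nat)" and lim: "((\<lambda>n. (s' n, c' n, d' n)) \<circ> r) \<longlonglongrightarrow> l"
    using bounded_imp_convergent_subsequence by blast
  obtain ls lc ld where l: "l = (ls, lc, ld)" by (cases l)
  have ls: "(\<lambda>n. s' (r n)) \<longlonglongrightarrow> ls" using tendsto_fst[OF lim] by (simp add: o_def l)
  have lc: "(\<lambda>n. c' (r n)) \<longlonglongrightarrow> lc" using tendsto_fst[OF tendsto_snd[OF lim]] by (simp add: o_def l)
  have ld: "(\<lambda>n. d' (r n)) \<longlonglongrightarrow> ld" using tendsto_snd[OF tendsto_snd[OF lim]] by (simp add: o_def l)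
  have lon: "on_jacobi B G (ls, lc, ld)"
  proof -
    have "(\<lambda>n. (c' (r n))\<^sup>2) \<longlonglongrightarrow> lc\<^sup>2" "(\<lambda>n. 1 - B * (s' (r n))\<^sup>2) \<longlonglongrightarrow> 1 - B * ls\<^sup>2"
         "(\<lambda>n. (d' (r n))\<^sup>2) \<longlonglongrightarrow> ld\<^sup>2" "(\<lambda>n. 1 - G * (s' (r n))\<^sup>2) \<longlonglongrightarrow> 1 - G * ls\<^sup>2"
      by (intro tendsto_intros ls lc ld)+
    thus ?thesis unfolding on_jacobi_def eqs by (auto intro: LIMSEQ_unique)
  qed
  have lD: "1 - B * G * ls\<^sup>2 * ls\<^sup>2 > 0" by (rule jacobi_denominator_pos[OF BG lon lon])
  \<comment> \<open>\<open>(S n, C n, E n)\<close> is the difference of two consecutive points; the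
    inverse of \<open>(s, c, d)\<close> is \<open>(- s, c, d)\<close>.\<close>
  define D where "D n = 1 - b * g * (s (r (Suc n)))\<^sup>2 * (- s (r n))\<^sup>2" for n
  define S where "S n = (s (r (Suc n)) * c (r n) * d (r n) + - s (r n) * c (r (Suc n)) * d (r (Suc n))) / D n" for n
  define C where "C n = (c (r (Suc n)) * c (r n) - b * s (r (Suc n)) * d (r (Suc n)) * - s (r n) * d (r n)) / D n" for n
  define E where "E n = (d (r (Suc n)) * d (r n) - g * s (r (Suc n)) * c (r (Suc n)) * - s (r n) * c (r n)) / D n" for n
  have D_real: "real_of_rat (D n) = 1 - B * G * (s' (r (Suc n)))\<^sup>2 * (- s' (r n))\<^sup>2" for n
    by (simp add: D_def B_def G_def s'_def of_rat_diff of_rat_mult of_rat_power)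
  have D_pos: "D n > 0" for n
  proof -
    have "real_of_rat (D n) > 0"
      unfolding D_real by (rule jacobi_denominator_pos[OF BG on' on_jacobi_neg[OF on']])
    thus ?thesis by simp
  qed
  have onS: "on_jacobi b g (S n, C n, E n)" for n
    using on_jacobi_add[OF on[of "r (Suc n)"] on_jacobi_neg[OF on[of "r n"]]] D_pos[of n]
    unfolding jacobi_add_def case_prod_conv Let_def D_def[symmetric] S_def C_def E_def by simp
  \<comment> \<open>After squaring, \<open>S n = 0\<close> becomes \<open>(s1\<^sup>2 - s2\<^sup>2)
    * (1 - b * g * s1\<^sup>2 * s2\<^sup>2) = 0\<close>, against the distinctness of the
    squares.\<close>
  have S0: "S n \<noteq> 0" for n
  proof
    assume "S n = 0"
    define s1 c1 d1 s2 c2 d2 where "s1 = s (r (Suc n))" "c1 = c (r (Suc n))" "d1 = d (r (Suc n))"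
      "s2 = s (r n)" "c2 = c (r n)" "d2 = d (r n)"
    note defs = this
    have "s1 * c2 * d2 = s2 * c1 * d1"
      using \<open>S n = 0\<close> D_pos[of n] unfolding S_def defs by simp
    hence "s1\<^sup>2 * c2\<^sup>2 * d2\<^sup>2 = s2\<^sup>2 * c1\<^sup>2 * d1\<^sup>2" by (metis power_mult_distrib)
    moreover have "c1\<^sup>2 = 1 - b * s1\<^sup>2" "d1\<^sup>2 = 1 - g * s1\<^sup>2" "c2\<^sup>2 = 1 - b * s2\<^sup>2" "d2\<^sup>2 = 1 - g * s2\<^sup>2"
      using on unfolding defs on_jacobi_def by auto
    ultimately have "s1\<^sup>2 * (1 - b * s2\<^sup>2) * (1 - g * s2\<^sup>2) = s2\<^sup>2 * (1 - b * s1\<^sup>2) * (1 - g * s1\<^sup>2)" by simp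
    hence "(s1\<^sup>2 - s2\<^sup>2) * (1 - b * g * s1\<^sup>2 * s2\<^sup>2) = 0" by algebra
    moreover have "1 - b * g * s1\<^sup>2 * s2\<^sup>2 \<noteq> 0" using D_pos[of n] unfolding D_def defs by simp
    ultimately have "s1\<^sup>2 = s2\<^sup>2" by simp
    hence "(fst (f (r (Suc n))))\<^sup>2 = (fst (f (r n)))\<^sup>2" unfolding defs s_def .
    hence "r (Suc n) = r n" using inj by (simp add: inj_def)
    thus False using r by (simp add: strict_mono_eq)
  qed
  have Suc_lim: "(\<lambda>n. s' (r (Suc n))) \<longlonglongrightarrow> ls" "(\<lambda>n. c' (r (Suc n))) \<longlonglongrightarrow> lc" "(\<lambda>n. d' (r (Suc n))) \<longlonglongrightarrow> ld"
    using LIMSEQ_Suc[OF ls] LIMSEQ_Suc[OF lc] LIMSEQ_Suc[OF ld] by auto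
  have D_lim: "(\<lambda>n. real_of_rat (D n)) \<longlonglongrightarrow> 1 - B * G * ls\<^sup>2 * (- ls)\<^sup>2"
    unfolding D_real by (intro tendsto_intros Suc_lim ls)
  have D_nz: "1 - B * G * ls\<^sup>2 * (- ls)\<^sup>2 \<noteq> 0" using lD by simp
  have lce: "lc\<^sup>2 = 1 - B * ls\<^sup>2" "ld\<^sup>2 = 1 - G * ls\<^sup>2" using lon by (auto simp: on_jacobi_def)
  have S_real: "real_of_rat (S n) = (s' (r (Suc n)) * c' (r n) * d' (r n) + - s' (r n) * c' (r (Suc n)) * d' (r (Suc n))) / real_of_rat (D n)" for n
    by (simp add: S_def s'_def c'_def d'_def of_rat_divide of_rat_diff of_rat_mult)
  have C_real: "real_of_rat (C n) = (c' (r (Suc n)) * c' (r n) - B * s' (r (Suc n)) * d' (r (Suc n)) * - s' (r n) * d' (r n)) / real_of_rat (D n)" for n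
    by (simp add: C_def B_def s'_def c'_def d'_def of_rat_divide of_rat_add of_rat_mult)
  have E_real: "real_of_rat (E n) = (d' (r (Suc n)) * d' (r n) - G * s' (r (Suc n)) * c' (r (Suc n)) * - s' (r n) * c' (r n)) / real_of_rat (D n)" for n
    by (simp add: E_def G_def s'_def c'_def d'_def of_rat_divide of_rat_add of_rat_mult)
  have "(\<lambda>n. real_of_rat (S n)) \<longlonglongrightarrow> (ls * lc * ld + - ls * lc * ld) / (1 - B * G * ls\<^sup>2 * (- ls)\<^sup>2)"
    unfolding S_real by (intro tendsto_intros Suc_lim ls lc ld D_lim D_nz)
  hence S_lim: "(\<lambda>n. real_of_rat (S n)) \<longlonglongrightarrow> 0" by simp
  have "(\<lambda>n. real_of_rat (C n)) \<longlonglongrightarrow> (lc * lc - B * ls * ld * - ls * ld) / (1 - B * G * ls\<^sup>2 * (- ls)\<^sup>2)"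
    unfolding C_real by (intro tendsto_intros Suc_lim ls lc ld D_lim D_nz)
  moreover have "lc * lc - B * ls * ld * - ls * ld = 1 - B * G * ls\<^sup>2 * (- ls)\<^sup>2" using lce by algebra
  ultimately have C_lim: "(\<lambda>n. real_of_rat (C n)) \<longlonglongrightarrow> 1" using D_nz by simp
  have "(\<lambda>n. real_of_rat (E n)) \<longlonglongrightarrow> (ld * ld - G * ls * lc * - ls * lc) / (1 - B * G * ls\<^sup>2 * (- ls)\<^sup>2)"
    unfolding E_real by (intro tendsto_intros Suc_lim ls lc ld D_lim D_nz)
  moreover have "ld * ld - G * ls * lc * - ls * lc = 1 - B * G * ls\<^sup>2 * (- ls)\<^sup>2" using lce by algebra
  ultimately have E_lim: "(\<lambda>n. real_of_rat (E n)) \<longlonglongrightarrow> 1" using D_nz by simp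
  \<comment> \<open>The negative sign is the one that will move the degenerate triangle to a shorter
    third side.\<close>
  have "on_jacobi b g (- \<bar>S n\<bar>, C n, E n) \<and> - \<bar>S n\<bar> < 0" for n
    using onS[of n] S0[of n] by (auto simp: on_jacobi_def)
  moreover have "(\<lambda>n. real_of_rat (- \<bar>S n\<bar>)) \<longlonglongrightarrow> 0"
    using tendsto_minus[OF tendsto_rabs[OF S_lim]] by (simp add: of_rat_minus)
  ultimately show ?thesis using C_lim E_lim by (intro exI[of _ "\<lambda>n. - \<bar>S n\<bar>"] exI[of _ C] exI[of _ E]) blast
qed

text \<open>For \<open>b < 0\<close> pass to the parameters \<open>- b\<close> and
  \<open>g - b\<close> by the imaginary transformation, and return by the same transformation, which
  is an involution.\<close>

lemma jacobi_small_points: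
  fixes b g :: rat
  assumes b: "b \<noteq> 0" and g: "g < b" and inf: "jacobi_infinite b g"
  shows "\<exists>s c d :: nat \<Rightarrow> rat. (\<forall>n. on_jacobi b g (s n, c n, d n) \<and> s n < 0) \<and>
    (\<lambda>n. real_of_rat (s n)) \<longlonglongrightarrow> 0 \<and> (\<lambda>n. real_of_rat (c n)) \<longlonglongrightarrow> 1 \<and> (\<lambda>n. real_of_rat (d n)) \<longlonglongrightarrow> 1"
proof (cases "b > 0")
  case True
  thus ?thesis using jacobi_small_points_pos g inf by blast
next
  case False
  hence bneg: "b < 0" using b by simp
  obtain f :: "nat \<Rightarrow> rat \<times> rat \<times> rat" where f: "\<And>n. on_jacobi b g (f n)" and inj: "inj (\<lambda>n. (fst (f n))\<^sup>2)"
    using inf unfolding jacobi_infinite_def by blast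
  define s c d where "s n = fst (f n)" and "c n = fst (snd (f n))" and "d n = snd (snd (f n))" for n
  have on: "on_jacobi b g (s n, c n, d n)" for n using f[of n] by (simp add: s_def c_def d_def)
  have ceq: "(c n)\<^sup>2 = 1 - b * (s n)\<^sup>2" for n using on[of n] by (simp add: on_jacobi_def)
  have cpos: "(c n)\<^sup>2 \<ge> 1" for n
    unfolding ceq using bneg mult_nonpos_nonneg[of b "(s n)\<^sup>2"] by simp
  have c0: "c n \<noteq> 0" for n using cpos[of n] by auto
  have "inj (\<lambda>n. (s n / c n)\<^sup>2)"
  proof (rule injI)
    fix i j assume "(s i / c i)\<^sup>2 = (s j / c j)\<^sup>2"
    hence "(s i)\<^sup>2 * (c j)\<^sup>2 = (s j)\<^sup>2 * (c i)\<^sup>2" using c0 by (simp add: field_simps)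
    hence "(s i)\<^sup>2 = (s j)\<^sup>2" unfolding ceq by (simp add: algebra_simps)
    thus "i = j" using inj by (simp add: inj_def s_def)
  qed
  moreover have "on_jacobi (- b) (g - b) (s n / c n, 1 / c n, d n / c n)" for n
    by (rule on_jacobi_imaginary[OF on c0])
  ultimately have "jacobi_infinite (- b) (g - b)" unfolding jacobi_infinite_def
    by (intro exI[of _ "\<lambda>n. (s n / c n, 1 / c n, d n / c n)"]) simp
  moreover have "- b > 0" "g - b < - b" using bneg g by auto
  ultimately obtain S C E where E: "\<And>n. on_jacobi (- b) (g - b) (S n, C n, E n)" "\<And>n. S n < 0"
    and lim: "(\<lambda>n. real_of_rat (S n)) \<longlonglongrightarrow> 0" "(\<lambda>n. real_of_rat (C n)) \<longlonglongrightarrow> 1" "(\<lambda>n. real_of_rat (E n)) \<longlonglongrightarrow> 1"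
    using jacobi_small_points_pos[of "- b" "g - b"] by blast
  \<comment> \<open>Dropping an initial segment makes \<open>C\<close> positive, so division by it
    keeps \<open>S\<close> negative.\<close>
  have "eventually (\<lambda>n. real_of_rat (C n) > 0) sequentially"
    using order_tendstoD(1)[OF lim(2), of 0] by simp
  then obtain N where N: "\<And>n. n \<ge> N \<Longrightarrow> C n > 0" by (auto simp: eventually_sequentially)
  define S' C' E' where "S' n = S (n + N) / C (n + N)" and "C' n = 1 / C (n + N)"
    and "E' n = E (n + N) / C (n + N)" for n
  have "on_jacobi b g (S' n, C' n, E' n) \<and> S' n < 0" for n
    using on_jacobi_imaginary[OF E(1)[of "n + N"]] N[of "n + N"] E(2)[of "n + N"]
    unfolding S'_def C'_def E'_def by (auto simp: divide_neg_pos)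
  moreover have "(\<lambda>n. real_of_rat (S' n)) \<longlonglongrightarrow> 0 / 1" "(\<lambda>n. real_of_rat (C' n)) \<longlonglongrightarrow> 1 / 1"
     "(\<lambda>n. real_of_rat (E' n)) \<longlonglongrightarrow> 1 / 1"
    unfolding S'_def C'_def E'_def of_rat_divide of_rat_1
    by (intro tendsto_divide tendsto_const one_neq_zero lim[THEN LIMSEQ_ignore_initial_segment])+
  ultimately show ?thesis by (intro exI[of _ S'] exI[of _ C'] exI[of _ E']) simp
qed

subsection \<open>The action on the median curve\<close>


text \<open>Up to a quadratic twist, the curve \<open>q\<^sup>2 (a3 - a4 p\<^sup>2) = a1 - a2 p\<^sup>2\<close> is parametrised by
  \<open>p = sn\<close> and \<open>q = dn / cn\<close>, so the Jacobi addition law acts on it; the twist cancels.\<close>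
lemma jacobi_action_identity:
  fixes a1 a2 a3 a4 p q s c d :: "'a::field"
  assumes c: "c\<^sup>2 = 1 - a1 * a4 * s\<^sup>2" and d: "d\<^sup>2 = 1 - a2 * a3 * s\<^sup>2"
    and pq: "q\<^sup>2 * (a3 - a4 * p\<^sup>2) = a1 - a2 * p\<^sup>2"
  shows "a3 * (1 - a4 * a2 * p\<^sup>2 * s\<^sup>2)\<^sup>2 - a4 * (p * c * d + s * q * (a3 - a4 * p\<^sup>2))\<^sup>2
      = (a3 - a4 * p\<^sup>2) * (c - a4 * p * q * s * d)\<^sup>2" (is ?A)
    and "a1 * (1 - a4 * a2 * p\<^sup>2 * s\<^sup>2)\<^sup>2 - a2 * (p * c * d + s * q * (a3 - a4 * p\<^sup>2))\<^sup>2
      = (a3 - a4 * p\<^sup>2) * (q * d - a2 * p * s * c)\<^sup>2" (is ?B)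
proof -
  define L where "L = a3 - a4 * p\<^sup>2"
  define X where "X = q\<^sup>2 * L"
  have X: "X = a1 - a2 * p\<^sup>2" using pq by (simp add: X_def L_def)
  have N: "(p * c * d + s * q * L)\<^sup>2 = p\<^sup>2 * c\<^sup>2 * d\<^sup>2 + 2 * p * c * d * s * q * L + s\<^sup>2 * X * L"
    unfolding X_def by algebra
  have "L * (c - a4 * p * q * s * d)\<^sup>2 = L * c\<^sup>2 - 2 * a4 * p * c * d * s * q * L + a4\<^sup>2 * p\<^sup>2 * s\<^sup>2 * d\<^sup>2 * X"
    unfolding X_def by algebra
  moreover have "a3 * (1 - a4 * a2 * p\<^sup>2 * s\<^sup>2)\<^sup>2 - a4 * (p\<^sup>2 * c\<^sup>2 * d\<^sup>2 + s\<^sup>2 * X * L)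
      = L * c\<^sup>2 + a4\<^sup>2 * p\<^sup>2 * s\<^sup>2 * d\<^sup>2 * X"
    unfolding c d X L_def by algebra
  ultimately show ?A unfolding L_def[symmetric] N by (simp add: algebra_simps)
  have "L * (q * d - a2 * p * s * c)\<^sup>2 = X * d\<^sup>2 - 2 * a2 * p * c * d * s * q * L + a2\<^sup>2 * p\<^sup>2 * s\<^sup>2 * c\<^sup>2 * L"
    unfolding X_def by algebra
  moreover have "a1 * (1 - a4 * a2 * p\<^sup>2 * s\<^sup>2)\<^sup>2 - a2 * (p\<^sup>2 * c\<^sup>2 * d\<^sup>2 + s\<^sup>2 * X * L)
      = X * d\<^sup>2 + a2\<^sup>2 * p\<^sup>2 * s\<^sup>2 * c\<^sup>2 * L"
    unfolding c d X L_def by algebra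
  ultimately show ?B unfolding L_def[symmetric] N by (simp add: algebra_simps)
qed

text \<open>Both identities carry the factor \<open>a3 - a4 * p\<^sup>2\<close>. It cancels in their
  quotient, which is the square of \<open>q'\<close>.\<close>

lemma jacobi_action:
  fixes a1 a2 a3 a4 p q s c d :: "'a::field"
  assumes "c\<^sup>2 = 1 - a1 * a4 * s\<^sup>2" "d\<^sup>2 = 1 - a2 * a3 * s\<^sup>2"
    and "q\<^sup>2 * (a3 - a4 * p\<^sup>2) = a1 - a2 * p\<^sup>2"
    and nz: "1 - a4 * a2 * p\<^sup>2 * s\<^sup>2 \<noteq> 0" "c - a4 * p * q * s * d \<noteq> 0"
    and p': "p' = (p * c * d + s * q * (a3 - a4 * p\<^sup>2)) / (1 - a4 * a2 * p\<^sup>2 * s\<^sup>2)"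
    and q': "q' = (q * d - a2 * p * s * c) / (c - a4 * p * q * s * d)"
  shows "q'\<^sup>2 * (a3 - a4 * p'\<^sup>2) = a1 - a2 * p'\<^sup>2"
proof -
  define N D M E L where "N = p * c * d + s * q * (a3 - a4 * p\<^sup>2)" and "D = 1 - a4 * a2 * p\<^sup>2 * s\<^sup>2"
    and "M = q * d - a2 * p * s * c" and "E = c - a4 * p * q * s * d" and "L = a3 - a4 * p\<^sup>2"
  have nz': "D \<noteq> 0" "E \<noteq> 0" using nz by (auto simp: D_def E_def)
  have A: "a3 * D\<^sup>2 - a4 * N\<^sup>2 = L * E\<^sup>2" and B: "a1 * D\<^sup>2 - a2 * N\<^sup>2 = L * M\<^sup>2"
    unfolding N_def D_def M_def E_def L_def by (rule jacobi_action_identity[OF assms(1-3)])+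
  have "a3 - a4 * p'\<^sup>2 = L * E\<^sup>2 / D\<^sup>2" "a1 - a2 * p'\<^sup>2 = L * M\<^sup>2 / D\<^sup>2"
    unfolding p' N_def[symmetric] D_def[symmetric] A[symmetric] B[symmetric]
    using nz' by (simp_all add: power_divide divide_simps)
  moreover have "q' = M / E" unfolding q' M_def E_def ..
  ultimately show ?thesis using nz' by (simp add: power_divide)
qed

text \<open>The substitutions \<open>P = (v - 1) / (v + 1)\<close> and
  \<open>Q = (t - 1) / (t + 1)\<close>, hyperbolic tangents of half the lengths, turn
  \<open>v + 1 / v\<close> into \<open>2 * (1 + P\<^sup>2) / (1 - P\<^sup>2)\<close>; then solve for
  \<open>Q\<^sup>2\<close>.\<close>

lemma median_curve_iff:
  fixes v t U W :: real
  assumes v: "v \<noteq> 0" "v \<noteq> - 1" and t: "t \<noteq> 0" "t \<noteq> - 1"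
  shows "W + v + 1 / v = U * (t + 1 / t) \<longleftrightarrow>
    ((t - 1) / (t + 1))\<^sup>2 * ((W + 2 + 2 * U) - (W - 2 + 2 * U) * ((v - 1) / (v + 1))\<^sup>2)
      = (W + 2 - 2 * U) - (W - 2 - 2 * U) * ((v - 1) / (v + 1))\<^sup>2"
proof -
  define P Q where "P = (v - 1) / (v + 1)" and "Q = (t - 1) / (t + 1)"
  have nz: "v + 1 \<noteq> 0" "t + 1 \<noteq> 0" using assms by auto
  have P: "P * (v + 1) = v - 1" and Q: "Q * (t + 1) = t - 1" unfolding P_def Q_def using nz by auto
  have "Q\<^sup>2 * ((W + 2 + 2 * U) - (W - 2 + 2 * U) * P\<^sup>2) = (W + 2 - 2 * U) - (W - 2 - 2 * U) * P\<^sup>2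
    \<longleftrightarrow> (t + 1)\<^sup>2 * (v + 1)\<^sup>2 * (Q\<^sup>2 * ((W + 2 + 2 * U) - (W - 2 + 2 * U) * P\<^sup>2))
      = (t + 1)\<^sup>2 * (v + 1)\<^sup>2 * ((W + 2 - 2 * U) - (W - 2 - 2 * U) * P\<^sup>2)"
    using nz by simp
  also have "(t + 1)\<^sup>2 * (v + 1)\<^sup>2 * (Q\<^sup>2 * ((W + 2 + 2 * U) - (W - 2 + 2 * U) * P\<^sup>2))
     = (Q * (t + 1))\<^sup>2 * ((W + 2 + 2 * U) * (v + 1)\<^sup>2 - (W - 2 + 2 * U) * (P * (v + 1))\<^sup>2)"
    by algebra
  also have "(t + 1)\<^sup>2 * (v + 1)\<^sup>2 * ((W + 2 - 2 * U) - (W - 2 - 2 * U) * P\<^sup>2)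
     = (t + 1)\<^sup>2 * ((W + 2 - 2 * U) * (v + 1)\<^sup>2 - (W - 2 - 2 * U) * (P * (v + 1))\<^sup>2)"
    by algebra
  also have "(Q * (t + 1))\<^sup>2 * ((W + 2 + 2 * U) * (v + 1)\<^sup>2 - (W - 2 + 2 * U) * (P * (v + 1))\<^sup>2)
      = (t + 1)\<^sup>2 * ((W + 2 - 2 * U) * (v + 1)\<^sup>2 - (W - 2 - 2 * U) * (P * (v + 1))\<^sup>2)
     \<longleftrightarrow> 16 * (U * v * (t * t + 1) - (W * v + v * v + 1) * t) = 0"
    unfolding P Q by (simp add: power2_eq_square algebra_simps)
  also have "\<dots> \<longleftrightarrow> W + v + 1 / v = U * (t + 1 / t)"
    using assms by (auto simp: field_simps)
  finally show ?thesis unfolding P_def Q_def by simp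
qed


text \<open>Points near the identity move the degenerate point \<open>(z, t0)\<close> to nearby
  rational points \<open>(V n, T n)\<close>. To first order \<open>p\<close> changes by
  \<open>s n * q * L\<close> with \<open>q * L > 0\<close>, so \<open>s n < 0\<close> puts
  \<open>V n\<close> strictly below its limit \<open>z\<close>.\<close>

lemma median_curve_near_degenerate:
  fixes u w :: real and s c d :: "nat \<Rightarrow> real"
  assumes u: "u > 1" "u \<in> \<rat>" and w: "w > 1" "w \<in> \<rat>"
    and rat: "\<And>n. s n \<in> \<rat>" "\<And>n. c n \<in> \<rat>" "\<And>n. d n \<in> \<rat>"
    and on: "\<And>n. on_jacobi (jb u w) (jg u w) (s n, c n, d n)" and s: "\<And>n. s n < 0"
    and lim: "s \<longlonglongrightarrow> 0" "c \<longlonglongrightarrow> 1" "d \<longlonglongrightarrow> 1"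
  shows "infinite {v \<in> \<rat>. u\<^sup>2 / w < v \<and> w / u\<^sup>2 < v \<and> v < u\<^sup>2 * w \<and>
    (\<exists>t\<in>\<rat>. t > 1 \<and> w + 1 / w + v + 1 / v = (u + 1 / u) * (t + 1 / t))}" (is "infinite ?X")
proof
  assume fin: "finite ?X"
  define U W where "U = u + 1 / u" and "W = w + 1 / w"
  define a1 a2 a3 a4 where "a1 = W + 2 - 2 * U" and "a2 = W - 2 - 2 * U"
    and "a3 = W + 2 + 2 * U" and "a4 = W - 2 + 2 * U"
  define z t0 where "z = u\<^sup>2 * w" and "t0 = u * w"
  define p q where "p = (z - 1) / (z + 1)" and "q = (t0 - 1) / (t0 + 1)"
  define L where "L = a3 - a4 * p\<^sup>2"
  have u2: "u\<^sup>2 > 1" using u by (simp add: one_less_power)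
  have "1 * 1 < u\<^sup>2 * w" "1 * 1 < u * w" using u2 u w by (intro mult_strict_mono; simp)+
  hence z1: "z > 1" and t1: "t0 > 1" unfolding z_def t0_def by simp_all
  have p01: "0 < p" "p < 1" and q01: "0 < q" "q < 1" unfolding p_def q_def using z1 t1 by (auto simp: field_simps)
  have U2: "U > 1" unfolding U_def using u zero_less_divide_1_iff[of u] by linarith
  have W0: "W > 0" unfolding W_def using w by (simp add: add_pos_pos)
  have a4: "a4 > 0" "a3 = a4 + 4" unfolding a4_def a3_def using U2 W0 by auto
  have "a4 * p\<^sup>2 < a4 * 1" using p01 a4 by (intro mult_strict_left_mono) (auto simp: power_less_one_iff abs_square_less_1)
  hence L: "L > 0" unfolding L_def using a4 by linarith
  have b: "jb u w = a1 * a4" and g: "jg u w = a2 * a3"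
    unfolding jb_def jg_def U_def[symmetric] W_def[symmetric] a1_def a2_def a3_def a4_def by algebra+
  have cd: "(c n)\<^sup>2 = 1 - a1 * a4 * (s n)\<^sup>2" "(d n)\<^sup>2 = 1 - a2 * a3 * (s n)\<^sup>2" for n
    using on[of n] unfolding on_jacobi_def b g by auto
  have "W + z + 1 / z = U * (t0 + 1 / t0)"
    unfolding W_def U_def z_def t0_def using u w by (simp add: field_simps power2_eq_square)
  hence curve: "q\<^sup>2 * (a3 - a4 * p\<^sup>2) = a1 - a2 * p\<^sup>2"
    unfolding a1_def a2_def a3_def a4_def p_def q_def using z1 t1 by (subst (asm) median_curve_iff) auto
  define D E where "D n = 1 - a4 * a2 * p\<^sup>2 * (s n)\<^sup>2" and "E n = c n - a4 * p * q * s n * d n" for n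
  define P where "P n = (p * c n * d n + s n * q * L) / D n" for n
  define Q where "Q n = (q * d n - a2 * p * s n * c n) / E n" for n
  have D_lim: "D \<longlonglongrightarrow> 1 - a4 * a2 * p\<^sup>2 * 0\<^sup>2" unfolding D_def by (intro tendsto_intros lim)
  have E_lim: "E \<longlonglongrightarrow> 1 - a4 * p * q * 0 * 1" unfolding E_def by (intro tendsto_intros lim)
  have "P \<longlonglongrightarrow> (p * 1 * 1 + 0 * q * L) / (1 - a4 * a2 * p\<^sup>2 * 0\<^sup>2)"
    unfolding P_def by (intro tendsto_intros lim D_lim) simp
  hence P_lim: "P \<longlonglongrightarrow> p" by simp
  have "Q \<longlonglongrightarrow> (q * 1 - a2 * p * 0 * 1) / (1 - a4 * p * q * 0 * 1)"
    unfolding Q_def by (intro tendsto_intros lim E_lim) simp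
  hence Q_lim: "Q \<longlonglongrightarrow> q" by simp
  define V T where "V n = (1 + P n) / (1 - P n)" and "T n = (1 + Q n) / (1 - Q n)" for n
  have "V \<longlonglongrightarrow> (1 + p) / (1 - p)" unfolding V_def using p01 by (intro tendsto_intros P_lim) simp
  moreover have "(1 + p) / (1 - p) = z" unfolding p_def using z1 by (simp add: field_simps)
  ultimately have V_lim: "V \<longlonglongrightarrow> z" by simp
  have "T \<longlonglongrightarrow> (1 + q) / (1 - q)" unfolding T_def using q01 by (intro tendsto_intros Q_lim) simp
  moreover have "(1 + q) / (1 - q) = t0" unfolding q_def using t1 by (simp add: field_simps)
  ultimately have T_lim: "T \<longlonglongrightarrow> t0" by simp

  \<comment> \<open>The quotient of \<open>P n - p\<close> by \<open>s n\<close>. The factor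
    \<open>s n\<close> is pulled out of \<open>c n * d n - 1\<close> by multiplying with
    \<open>c n * d n + 1\<close>.\<close>
  define R where "R n = (p * (s n * (- (a1 * a4 + a2 * a3) + a1 * a4 * (a2 * a3) * (s n)\<^sup>2) / (c n * d n + 1))
      + q * L + a4 * a2 * p ^ 3 * s n) / D n" for n
  have "R \<longlonglongrightarrow> (p * (0 * (- (a1 * a4 + a2 * a3) + a1 * a4 * (a2 * a3) * 0\<^sup>2) / (1 * 1 + 1))
      + q * L + a4 * a2 * p ^ 3 * 0) / (1 - a4 * a2 * p\<^sup>2 * 0\<^sup>2)"
    unfolding R_def by (intro tendsto_intros lim D_lim) simp_all
  hence R_lim: "R \<longlonglongrightarrow> q * L" by simp
  have PR: "P n - p = s n * R n" if "D n \<noteq> 0" "c n * d n + 1 \<noteq> 0" for n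
  proof -
    define k where "k = - (a1 * a4 + a2 * a3) + a1 * a4 * (a2 * a3) * (s n)\<^sup>2"
    have "(c n * d n - 1) * (c n * d n + 1) = (c n)\<^sup>2 * (d n)\<^sup>2 - 1" by (simp add: algebra_simps power2_eq_square)
    also have "\<dots> = (s n)\<^sup>2 * k" unfolding cd k_def by (simp add: algebra_simps power2_eq_square)
    finally have *: "s n * (s n * k / (c n * d n + 1)) = c n * d n - 1"
      using that by (simp add: field_simps power2_eq_square)
    have "s n * R n * D n = p * (s n * (s n * k / (c n * d n + 1))) + s n * q * L + a4 * a2 * p ^ 3 * (s n)\<^sup>2"
    proof -
      have "R n * D n = p * (s n * k / (c n * d n + 1)) + q * L + a4 * a2 * p ^ 3 * s n"
        unfolding R_def k_def[symmetric] using that(1) by simp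
      hence "s n * R n * D n = s n * (p * (s n * k / (c n * d n + 1)) + q * L + a4 * a2 * p ^ 3 * s n)"
        by (simp only: mult.assoc)
      thus ?thesis by (simp add: algebra_simps power2_eq_square)
    qed
    also have "\<dots> = (P n - p) * D n"
    proof -
      have "P n * D n = p * c n * d n + s n * q * L" unfolding P_def using that(1) by simp
      thus ?thesis unfolding * left_diff_distrib
        by (simp add: D_def algebra_simps power2_eq_square power3_eq_cube)
    qed
    finally show ?thesis using that(1) by simp
  qed

  have cd_lim: "(\<lambda>n. c n * d n + 1) \<longlonglongrightarrow> 1 * 1 + 1" by (intro tendsto_intros lim)
  have zw: "u\<^sup>2 / w < z" "w / u\<^sup>2 < z"
  proof -
    have "u\<^sup>2 / w < u\<^sup>2 / 1" using u w by (intro divide_strict_left_mono) auto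
    also have "\<dots> < z" unfolding z_def using u w by simp
    finally show "u\<^sup>2 / w < z" .
    have "w / u\<^sup>2 < w / 1" using u2 w by (intro divide_strict_left_mono) auto
    also have "\<dots> < z" unfolding z_def using u2 w by simp
    finally show "w / u\<^sup>2 < z" .
  qed
  have ev: "eventually (\<lambda>n. V n \<in> ?X) sequentially"
  proof -
    have e: "eventually (\<lambda>n. D n > 0) sequentially" "eventually (\<lambda>n. E n > 0) sequentially"
      "eventually (\<lambda>n. c n * d n + 1 > 0) sequentially" "eventually (\<lambda>n. R n > 0) sequentially"
      "eventually (\<lambda>n. P n > 0) sequentially" "eventually (\<lambda>n. P n < 1) sequentially"
      "eventually (\<lambda>n. Q n > 0) sequentially" "eventually (\<lambda>n. Q n < 1) sequentially"
      "eventually (\<lambda>n. V n > u\<^sup>2 / w) sequentially" "eventually (\<lambda>n. V n > w / u\<^sup>2) sequentially"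
      using order_tendstoD(1)[OF D_lim, of 0] order_tendstoD(1)[OF E_lim, of 0]
        order_tendstoD(1)[OF cd_lim, of 0] order_tendstoD(1)[OF R_lim, of 0]
        order_tendstoD[OF P_lim] order_tendstoD[OF Q_lim] order_tendstoD(1)[OF V_lim] zw p01 q01 L
      by auto
    show ?thesis using e
    proof eventually_elim
      case (elim n)
      have "P n - p < 0" using PR[of n] elim s[of n] by (simp add: mult_neg_pos)
      hence "V n < (1 + p) / (1 - p)" unfolding V_def using elim p01 by (simp add: divide_simps algebra_simps)
      hence Vz: "V n < z" using \<open>(1 + p) / (1 - p) = z\<close> by simp
      have V0: "V n > 0" unfolding V_def using elim by simp
      have T1: "T n > 1" unfolding T_def using elim by (simp add: field_simps)
      have "(V n - 1) / (V n + 1) = P n" "(T n - 1) / (T n + 1) = Q n"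
        unfolding V_def T_def using elim by (simp_all add: divide_simps)
      moreover have "(Q n)\<^sup>2 * (a3 - a4 * (P n)\<^sup>2) = a1 - a2 * (P n)\<^sup>2"
        by (rule jacobi_action[OF cd curve _ _ P_def[unfolded D_def L_def] Q_def[unfolded E_def]])
           (use elim in \<open>auto simp: D_def E_def\<close>)
      ultimately have "W + V n + 1 / V n = U * (T n + 1 / T n)"
        using V0 T1 by (subst median_curve_iff) (auto simp: a1_def a2_def a3_def a4_def)
      moreover have "W \<in> \<rat>" "U \<in> \<rat>" using u w unfolding W_def U_def by auto
      hence "V n \<in> \<rat>" "T n \<in> \<rat>"
        using u w rat[of n] unfolding V_def T_def P_def Q_def D_def E_def L_def p_def q_def z_def t0_def
          a1_def a2_def a3_def a4_def by auto
      ultimately show ?case using elim Vz T1 unfolding z_def U_def W_def by auto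
    qed
  qed
  \<comment> \<open>A finite set is closed and would contain the limit \<open>z\<close>, which the
    strict bound \<open>v < u\<^sup>2 * w\<close> forbids.\<close>
  have "z \<in> ?X"
    by (rule Lim_in_closed_set[OF finite_imp_closed[OF fin] ev _ V_lim]) simp
  thus False unfolding z_def by simp
qed

subsection \<open>Triangles in the upper half-plane\<close>


lemma hdist_commute: "hdist z w = hdist w z"
  by (simp add: hdist_def norm_minus_commute mult_ac)

lemma arcosh_half_sum_inverse:
  fixes x :: real
  assumes "x \<ge> 1"
  shows "arcosh ((x + 1 / x) / 2) = ln x"
proof -
  have "(x + 1 / x) / 2 = cosh (ln x)" using assms by (simp add: cosh_ln_real inverse_eq_divide)
  thus ?thesis using assms by (simp add: arcosh_cosh_real)
qed

text \<open>Twice the hyperbolic cosine of this distance is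
  \<open>(x\<^sup>2 + y\<^sup>2 + k\<^sup>2) / (y * k)\<close>.\<close>

lemma hdist_imaginary_axis:
  assumes "y > 0" "k > 0" "l \<ge> 1" "(x\<^sup>2 + y\<^sup>2 + k\<^sup>2) / (y * k) = l + 1 / l"
  shows "hdist (Complex x y) (Complex 0 k) = ln l"
proof -
  have "(cmod (Complex x y - Complex 0 k))\<^sup>2 = x\<^sup>2 + (y - k)\<^sup>2" by (simp add: cmod_power2)
  hence "1 + (cmod (Complex x y - Complex 0 k))\<^sup>2 / (2 * y * k) = (x\<^sup>2 + y\<^sup>2 + k\<^sup>2) / (y * k) / 2"
    using assms(1,2) by (simp add: field_simps power2_eq_square)
  also have "\<dots> = (l + 1 / l) / 2" using assms(4) by simp
  finally show ?thesis
    unfolding hdist_def complex.sel using arcosh_half_sum_inverse[OF assms(3)] by (simp only:)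
qed

lemma add_inverse_strict_mono:
  fixes x y :: real
  assumes "0 < x" "x < y" "x * y > 1"
  shows "x + 1 / x < y + 1 / y"
proof -
  have "(y + 1 / y) - (x + 1 / x) = (y - x) * (1 - 1 / (x * y))" using assms by (simp add: field_simps)
  moreover have "1 / (x * y) < 1" using assms by simp
  ultimately show ?thesis using assms by (metis diff_gt_0_iff_gt mult_pos_pos)
qed

text \<open>Put the side \<open>a\<close> on the imaginary axis with midpoint \<open>\<i>\<close>,
  so that \<open>B\<close> and \<open>C\<close> have heights \<open>1 / u\<close> and
  \<open>u\<close>. Subtracting the two distance equations for \<open>A = Complex x y\<close> gives
  \<open>y * K = e\<close>; either equation then gives \<open>x\<^sup>2\<close>.\<close>

lemma triangle_with_median:
  fixes u w v t :: real
  assumes u: "u > 1" and w: "w > 1" and v: "u\<^sup>2 / w < v" "w / u\<^sup>2 < v" "v < u\<^sup>2 * w" and t: "t > 1"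
    and eq: "w + 1 / w + v + 1 / v = (u + 1 / u) * (t + 1 / t)"
  shows "\<exists>A B C M. hyp_triangle A B C \<and> hdist B C = 2 * ln u \<and> hdist C A = ln w \<and> hdist A B = ln v \<and>
     hmidpoint B C M \<and> hdist A M = ln t"
proof -
  define W V where "W = w + 1 / w" and "V = v + 1 / v"
  define m where "m = u\<^sup>2 / w"
  define e where "e = u\<^sup>2 - 1 / u\<^sup>2"
  have u2: "u\<^sup>2 > 1" using u by (simp add: one_less_power)
  have m0: "m > 0" unfolding m_def using u w by simp
  have mv: "m < v" "1 / m < v" using v unfolding m_def by auto
  have v0: "v > 0" using mv m0 by simp
  have mv1: "m * v > 1" using mv(2) m0 by (simp add: field_simps)
  have v1: "v > 1"
  proof (rule ccontr)
    assume "\<not> v > 1"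
    hence "m * v \<le> 1 * 1" using mv m0 v0 by (intro mult_mono) auto
    thus False using mv1 by simp
  qed
  have V_lower: "m + 1 / m < V" unfolding V_def using add_inverse_strict_mono[OF m0 mv(1) mv1] .
  have "1 * 1 < v * (u\<^sup>2 * w)" using v1 v(3) by (intro mult_strict_mono) auto
  hence V_upper: "V < u\<^sup>2 * w + 1 / (u\<^sup>2 * w)"
    unfolding V_def using add_inverse_strict_mono[OF v0 v(3)] by simp
  define K where "K = W * u - V / u"
  have e0: "e > 0"
  proof -
    have "1 / u\<^sup>2 < 1 / 1" using u2 u by (intro divide_strict_left_mono) auto
    thus ?thesis unfolding e_def using u2 by linarith
  qed
  have K0: "K > 0"
  proof -
    have "1 / (u\<^sup>2 * w) < u\<^sup>2 / w" using e0 u w unfolding e_def by (simp add: field_simps)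
    hence "V < u\<^sup>2 * w + u\<^sup>2 / w" using V_upper by linarith
    also have "\<dots> = W * u * u" unfolding W_def by (simp add: algebra_simps power2_eq_square)
    finally have "V / u < W * u" using u by (simp add: field_simps)
    thus ?thesis unfolding K_def by simp
  qed
  define y where "y = e / K"
  have y0: "y > 0" unfolding y_def using e0 K0 by simp
  define X where "X = W * u * y - u\<^sup>2 - y\<^sup>2"
  have X0: "X > 0"
  proof -
    \<comment> \<open>Solvability for \<open>x\<close> is the strict triangle inequality:
      \<open>V\<close> lies between the values of the two degenerate triangles.\<close>
    have "K\<^sup>2 * X = W * u * e * K - u\<^sup>2 * K\<^sup>2 - e\<^sup>2"
      unfolding X_def y_def using K0 by (simp add: field_simps power2_eq_square)
    also have "\<dots> = (u\<^sup>2 * w + 1 / (u\<^sup>2 * w) - V) * (V - (m + 1 / m))"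
      unfolding K_def e_def W_def m_def using u w by (simp add: field_simps power2_eq_square)
    also have "\<dots> > 0" using V_lower V_upper by simp
    finally show ?thesis using K0 by (simp add: zero_less_mult_iff)
  qed
  define x where "x = sqrt X"
  have x2: "x\<^sup>2 = X" unfolding x_def using X0 by simp
  define A B C M where "A = Complex x y" and "B = Complex 0 (1 / u)" and "C = Complex 0 u" and "M = Complex 0 1"
  have R: "x\<^sup>2 + y\<^sup>2 = W * u * y - u\<^sup>2" unfolding x2 X_def by simp
  have yK: "y * K = e" unfolding y_def using K0 by simp
  have R': "x\<^sup>2 + y\<^sup>2 + (1 / u)\<^sup>2 = V * y / u"
  proof -
    have "x\<^sup>2 + y\<^sup>2 + (1 / u)\<^sup>2 = W * u * y - e" unfolding R e_def by (simp add: power_divide)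
    also have "\<dots> = V * y / u" unfolding yK[symmetric] K_def by (simp add: algebra_simps)
    finally show ?thesis .
  qed
  have AC: "hdist A C = ln w" unfolding A_def C_def
  proof (rule hdist_imaginary_axis[OF y0])
    show "(x\<^sup>2 + y\<^sup>2 + u\<^sup>2) / (y * u) = w + 1 / w" unfolding R using y0 u by (simp add: W_def)
  qed (use u w in auto)
  have AB: "hdist A B = ln v" unfolding A_def B_def
  proof (rule hdist_imaginary_axis[OF y0])
    show "(x\<^sup>2 + y\<^sup>2 + (1 / u)\<^sup>2) / (y * (1 / u)) = v + 1 / v" unfolding R' using y0 u by (simp add: V_def)
  qed (use u v1 in auto)
  have AM: "hdist A M = ln t" unfolding A_def M_def
  proof (rule hdist_imaginary_axis[OF y0])
    \<comment> \<open>The median formula: dividing one distance equation by \<open>u\<close> and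
      multiplying the other by \<open>u\<close> makes the constants add up to
      \<open>u + 1 / u\<close>.\<close>
    have "(x\<^sup>2 + y\<^sup>2 + 1) * (u + 1 / u) = (x\<^sup>2 + y\<^sup>2 + u\<^sup>2) / u + (x\<^sup>2 + y\<^sup>2 + (1 / u)\<^sup>2) * u"
      using u by (simp add: field_simps power2_eq_square)
    also have "\<dots> = (W + V) * y" unfolding R' using R u by (simp add: field_simps)
    also have "\<dots> = (u + 1 / u) * (t + 1 / t) * y" using eq unfolding W_def V_def by (simp add: add.assoc)
    finally have "(u + 1 / u) * (x\<^sup>2 + y\<^sup>2 + 1) = (u + 1 / u) * ((t + 1 / t) * y)" by (simp add: mult_ac)
    moreover have "u + 1 / u \<noteq> 0" using u by (simp add: add_pos_pos less_imp_neq[symmetric])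
    ultimately have "x\<^sup>2 + y\<^sup>2 + 1 = (t + 1 / t) * y" by (metis mult_left_cancel)
    thus "(x\<^sup>2 + y\<^sup>2 + 1\<^sup>2) / (y * 1) = t + 1 / t" using y0 by simp
  qed (use t in auto)
  have CB: "hdist C B = ln (u\<^sup>2)" unfolding C_def B_def
    by (rule hdist_imaginary_axis) (use u u2 in \<open>auto simp: power_divide\<close>)
  have "ln (u\<^sup>2) = 2 * ln u" using u by (simp add: ln_realpow)
  hence BC: "hdist B C = 2 * ln u" using CB hdist_commute by metis
  have CM: "hdist C M = ln u" unfolding C_def M_def
    by (rule hdist_imaginary_axis) (use u in \<open>auto simp: field_simps power2_eq_square\<close>)
  have BM: "hdist B M = ln u" unfolding B_def M_def
    by (rule hdist_imaginary_axis) (use u in \<open>auto simp: field_simps power2_eq_square\<close>)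
  have lns: "ln w - 2 * ln u < ln v" "2 * ln u - ln w < ln v" "ln v < 2 * ln u + ln w"
  proof -
    have "ln (w / u\<^sup>2) < ln v" "ln (u\<^sup>2 / w) < ln v" "ln v < ln (u\<^sup>2 * w)"
      using v v0 u w by (simp_all add: ln_less_cancel_iff)
    thus "ln w - 2 * ln u < ln v" "2 * ln u - ln w < ln v" "ln v < 2 * ln u + ln w"
      using u w by (simp_all add: ln_div ln_mult ln_realpow)
  qed
  have "\<not> hcollinear A B C"
    unfolding hcollinear_def hdist_commute[of B A] hdist_commute[of C B] AB AC BC using lns by auto
  hence "hyp_triangle A B C"
    unfolding hyp_triangle_def hplane_def A_def B_def C_def using y0 u by auto
  moreover have "hmidpoint B C M"
    unfolding hmidpoint_def BC BM hdist_commute[of M C] CM by (simp add: hplane_def M_def)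
  ultimately show ?thesis
    using BC AC AB AM hdist_commute[of C A] by (intro exI[of _ A] exI[of _ B] exI[of _ C] exI[of _ M]) auto
qed

subsection \<open>The exceptional curve\<close>


lemma of_rat_jb: "real_of_rat (jb u w) = jb (real_of_rat u) (real_of_rat w)"
  and of_rat_jg: "real_of_rat (jg u w) = jg (real_of_rat u) (real_of_rat w)"
  by (simp_all add: jb_def jg_def of_rat_diff of_rat_add of_rat_mult of_rat_power of_rat_divide)

text \<open>The outer variable is \<open>u\<close> and the inner one \<open>w\<close>. Nested
  polynomials allow the exceptional curve to be written as a product; here it becomes an array of
  coefficients.\<close>

lemma bivariate_poly_as_sum:
  fixes P :: "rat poly poly"
  assumes "P \<noteq> 0"
  shows "\<exists>N (c :: nat \<Rightarrow> nat \<Rightarrow> rat). (\<exists>i\<le>N. \<exists>j\<le>N. c i j \<noteq> 0) \<and>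
    (\<forall>u w. (\<Sum>i\<le>N. \<Sum>j\<le>N. c i j * u ^ i * w ^ j) = poly (poly P [:u:]) w)"
proof -
  define N where "N = degree P + Max (degree ` coeff P ` {..degree P})"
  define c where "c i j = coeff (coeff P i) j" for i j
  have deg: "degree (coeff P i) \<le> N" for i
  proof (cases "i \<le> degree P")
    case True
    hence "degree (coeff P i) \<le> Max (degree ` coeff P ` {..degree P})" by (intro Max_ge) auto
    thus ?thesis unfolding N_def by simp
  next
    case False
    thus ?thesis by (simp add: coeff_eq_0)
  qed
  have sum_coeff: "poly p x = (\<Sum>j\<le>N. coeff p j * x ^ j)" if "degree p \<le> N" for p :: "'a::comm_semiring_1 poly" and x
    unfolding poly_altdef using that
    by (intro sum.mono_neutral_left) (auto simp: coeff_eq_0)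
  have "(\<Sum>i\<le>N. \<Sum>j\<le>N. c i j * u ^ i * w ^ j) = poly (poly P [:u:]) w" for u w
  proof -
    have "poly (poly P [:u:]) w = poly (\<Sum>i\<le>N. coeff P i * [:u:] ^ i) w"
      by (subst sum_coeff) (simp_all add: N_def)
    also have "\<dots> = (\<Sum>i\<le>N. poly (coeff P i) w * u ^ i)" by (simp add: poly_sum)
    also have "\<dots> = (\<Sum>i\<le>N. (\<Sum>j\<le>N. coeff (coeff P i) j * w ^ j) * u ^ i)"
      using deg by (simp add: sum_coeff)
    also have "\<dots> = (\<Sum>i\<le>N. \<Sum>j\<le>N. c i j * u ^ i * w ^ j)"
      by (simp add: c_def sum_distrib_left sum_distrib_right mult_ac)
    finally show ?thesis by simp
  qed
  moreover have "\<exists>i\<le>N. \<exists>j\<le>N. c i j \<noteq> 0"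
  proof -
    have "coeff P (degree P) \<noteq> 0" using assms by simp
    hence "c (degree P) (degree (coeff P (degree P))) \<noteq> 0" by (simp add: c_def)
    moreover have "degree P \<le> N" by (simp add: N_def)
    ultimately show ?thesis using deg by blast
  qed
  ultimately show ?thesis by blast
qed

text \<open>The denominator is smaller than the numerator, so only finitely many \<open>u\<close>,
  hence finitely many lines of the plane, are concerned.\<close>

lemma numerator_le_8_cases:
  assumes "u > 1" "fst (quotient_of u) \<le> 8"
  shows "u \<in> (\<lambda>(a, b). of_int a / of_int b) ` ({1..8} \<times> {1..8})"
proof -
  obtain a b where q: "quotient_of u = (a, b)" by fastforce
  have b: "b > 0" using quotient_of_denom_pos[OF q] .
  have u: "u = of_int a / of_int b" using quotient_of_div[OF q] .
  have "a > b" using assms(1) b unfolding u by simp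
  thus ?thesis using b u assms(2) q by (auto intro!: image_eqI[of _ _ "(a, b)"])
qed

text \<open>\<open>jb\<close> is a difference of squares. One factor is positive, and the other is
  the given polynomial divided by \<open>u * w\<close>.\<close>

lemma jb_nonzero:
  fixes u w :: rat
  assumes "u > 1" "w > 1" "u * (w\<^sup>2 + 1) - 2 * w * (u\<^sup>2 + 1) + 2 * u * w \<noteq> 0"
  shows "jb u w \<noteq> 0"
proof -
  define U W where "U = u + 1 / u" and "W = w + 1 / w"
  have "U > 1" unfolding U_def using assms(1) zero_less_divide_1_iff[of u] by linarith
  moreover have "W > 1" unfolding W_def using assms(2) zero_less_divide_1_iff[of w] by linarith
  ultimately have "W + 2 * U - 2 \<noteq> 0" by simp
  moreover have "u * w * (W - 2 * U + 2) \<noteq> 0"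
  proof -
    have "w * W = w\<^sup>2 + 1" "u * U = u\<^sup>2 + 1"
      unfolding W_def U_def using assms(1,2) by (simp_all add: field_simps power2_eq_square)
    moreover have "u * w * (W - 2 * U + 2) = u * (w * W) - 2 * w * (u * U) + 2 * u * w"
      by (simp add: algebra_simps)
    ultimately show ?thesis using assms(3) by simp
  qed
  moreover have "jb u w = (W - 2 * U + 2) * (W + 2 * U - 2)"
    unfolding jb_def U_def[symmetric] W_def[symmetric] by algebra
  ultimately show ?thesis by auto
qed

lemma jg_less_jb:
  fixes u w :: rat
  assumes "u > 1" shows "jg u w < jb u w"
proof -
  have "jb u w - jg u w = 16 * (u + 1 / u)" unfolding jb_def jg_def by algebra
  moreover have "u + 1 / u > 0" using assms zero_less_divide_1_iff[of u] by linarith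
  ultimately show ?thesis by simp
qed


text \<open>Distinct \<open>v\<close> give distinct third sides \<open>ln v\<close>, so the
  triangles counted are pairwise non-congruent.\<close>

lemma infinite_third_sides:
  fixes u w :: rat
  assumes u: "u > 1" and w: "w > 1" and ne: "u \<noteq> w" "u\<^sup>2 \<noteq> w" and num: "fst (quotient_of u) > 8"
    and b: "u * (w\<^sup>2 + 1) - 2 * w * (u\<^sup>2 + 1) + 2 * u * w \<noteq> 0"
  shows "infinite {l :: real. \<exists>A B C.
            hyp_triangle A B C \<and>
            hdist B C = 2 * ln (real_of_rat u) \<and>
            hdist C A = ln (real_of_rat w) \<and>
            hdist A B = l \<and>
            rational_length (hdist B C) \<and> rational_length (hdist C A) \<and>
            rational_length (hdist A B) \<and>
            (\<exists>M. hmidpoint B C M \<and> rational_length (hdist A M))}" (is "infinite ?Y")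
proof -
  define u' w' where "u' = real_of_rat u" and "w' = real_of_rat w"
  have u': "u' > 1" "u' \<in> \<rat>" and w': "w' > 1" "w' \<in> \<rat>" using u w by (auto simp: u'_def w'_def)
  obtain s c d :: "nat \<Rightarrow> rat" where
    on: "\<And>n. on_jacobi (jb u w) (jg u w) (s n, c n, d n)" and s: "\<And>n. s n < 0" and
    lim: "(\<lambda>n. real_of_rat (s n)) \<longlonglongrightarrow> 0" "(\<lambda>n. real_of_rat (c n)) \<longlonglongrightarrow> 1"
      "(\<lambda>n. real_of_rat (d n)) \<longlonglongrightarrow> 1"
    using jacobi_small_points[OF jb_nonzero[OF u w b] jg_less_jb[OF u]
        jacobi_infinite_if_large_numerator[OF u w ne num]] by blast
  define X where "X = {v \<in> \<rat>. u'\<^sup>2 / w' < v \<and> w' / u'\<^sup>2 < v \<and> v < u'\<^sup>2 * w' \<and>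
    (\<exists>t\<in>\<rat>. t > 1 \<and> w' + 1 / w' + v + 1 / v = (u' + 1 / u') * (t + 1 / t))}"
  have "infinite X" unfolding X_def
  proof (rule median_curve_near_degenerate[OF u' w' _ _ _ _ _ lim])
    show "on_jacobi (jb u' w') (jg u' w') (real_of_rat (s n), real_of_rat (c n), real_of_rat (d n))" for n
      using on[of n] on_jacobi_of_rat of_rat_jb of_rat_jg unfolding u'_def w'_def by metis
  qed (use s in auto)
  moreover have pos: "v > 0" if "v \<in> X" for v
  proof -
    have "u'\<^sup>2 / w' > 0" using u' w' by simp
    thus ?thesis using that unfolding X_def by simp
  qed
  hence "inj_on ln X" by (auto simp: inj_on_def)
  ultimately have "infinite (ln ` X)" by (simp add: finite_image_iff)
  moreover have "ln ` X \<subseteq> ?Y"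
  proof
    fix l assume "l \<in> ln ` X"
    then obtain v where v: "v \<in> X" "l = ln v" by blast
    then obtain t where t: "t \<in> \<rat>" "t > 1" "w' + 1 / w' + v + 1 / v = (u' + 1 / u') * (t + 1 / t)"
      unfolding X_def by auto
    obtain A B C M where tri: "hyp_triangle A B C" "hdist B C = 2 * ln u'" "hdist C A = ln w'"
        "hdist A B = ln v" "hmidpoint B C M" "hdist A M = ln t"
      using triangle_with_median[OF u'(1) w'(1) _ _ _ t(2,3)] v(1) unfolding X_def by blast
    have "exp (2 * ln u') = u'\<^sup>2" using u' by (simp add: exp_double)
    hence "rational_length (hdist B C)" "rational_length (hdist C A)" "rational_length (hdist A B)"
      "rational_length (hdist A M)"
      using u' w' v(1) pos[OF v(1)] t tri(2-4,6) unfolding rational_length_def X_def by auto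
    moreover have "hdist A B = l" using tri(4) v(2) by simp
    ultimately show "l \<in> ?Y"
      using tri(1-3,5) unfolding u'_def w'_def mem_Collect_eq by blast
  qed
  ultimately show ?thesis using finite_subset by blast
qed

theorem mainTheorem12:
  shows "\<exists>(N::nat) (c::nat \<Rightarrow> nat \<Rightarrow> rat).
     (\<exists>i\<le>N. \<exists>j\<le>N. c i j \<noteq> 0) \<and>
     (\<forall>u w :: rat. u > 1 \<longrightarrow> w > 1 \<longrightarrow>
        (\<Sum>i\<le>N. \<Sum>j\<le>N. c i j * u ^ i * w ^ j) \<noteq> 0 \<longrightarrow>
        infinite {l :: real. \<exists>A B C.
            hyp_triangle A B C \<and>
            hdist B C = 2 * ln (real_of_rat u) \<and>
            hdist C A = ln (real_of_rat w) \<and>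
            hdist A B = l \<and>
            rational_length (hdist B C) \<and> rational_length (hdist C A) \<and>
            rational_length (hdist A B) \<and>
            (\<exists>M. hmidpoint B C M \<and> rational_length (hdist A M))})"
proof -
  define S :: "rat set" where "S = (\<lambda>(a, b). of_int a / of_int b) ` ({1..8} \<times> {1..8})"
  have S: "finite S" unfolding S_def by simp
  define X Y :: "rat poly poly" where "X = [:0, 1:]" and "Y = [:[:0, 1:]:]"
  \<comment> \<open>The factors exclude, in turn, small numerators of \<open>u\<close>, the cases
    \<open>u = w\<close> and \<open>u\<^sup>2 = w\<close>, and the zeros of
    \<open>jb\<close>.\<close>
  define P where "P = (\<Prod>x\<in>S. X - [:[:x:]:]) * (X - Y) * (X * X - Y) *
    (X * (Y * Y + 1) - (Y + Y) * (X * X + 1) + (X + X) * Y)"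
  have ev: "poly (poly P [:u:]) w = (\<Prod>x\<in>S. u - x) * (u - w) * (u\<^sup>2 - w) *
      (u * (w\<^sup>2 + 1) - 2 * w * (u\<^sup>2 + 1) + 2 * u * w)" for u w
    unfolding P_def X_def Y_def by (simp add: poly_prod power2_eq_square algebra_simps)
  have "x \<le> 8" if "x \<in> S" for x
  proof -
    from that obtain a b :: int where ab: "1 \<le> b" "a \<le> 8" "x = of_int a / of_int b"
      unfolding S_def by auto
    have "a \<le> 8 * b" using ab by linarith
    hence "(of_int a :: rat) \<le> of_int (8 * b)" by (simp only: of_int_le_iff)
    thus ?thesis using ab by (simp add: divide_le_eq)
  qed
  hence "(100 :: rat) - x \<noteq> 0" if "x \<in> S" for x using that by fastforce
  \<comment> \<open>The point \<open>u = 100\<close>, \<open>w = 2\<close> lies off the curve, so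
    the curve is proper.\<close>
  hence "poly (poly P [:100:]) 2 \<noteq> 0" unfolding ev using S by (simp add: prod_zero_iff)
  hence "P \<noteq> 0" by auto
  from bivariate_poly_as_sum[OF this] obtain N c where
    c: "\<exists>i\<le>N. \<exists>j\<le>N. c i j \<noteq> 0"
    and sum: "\<And>u w. (\<Sum>i\<le>N. \<Sum>j\<le>N. c i j * u ^ i * w ^ j) = poly (poly P [:u:]) w"
    by blast
  show ?thesis
  proof (rule exI[of _ N], rule exI[of _ c], intro conjI allI impI)
    fix u w :: rat
    assume u: "u > 1" and w: "w > 1" and nz: "(\<Sum>i\<le>N. \<Sum>j\<le>N. c i j * u ^ i * w ^ j) \<noteq> 0"
    have f: "u \<notin> S" "u \<noteq> w" "u\<^sup>2 \<noteq> w" "u * (w\<^sup>2 + 1) - 2 * w * (u\<^sup>2 + 1) + 2 * u * w \<noteq> 0"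
      using nz S unfolding sum ev by (auto simp: prod_zero_iff)
    have "fst (quotient_of u) > 8"
      using numerator_le_8_cases[OF u] f(1) unfolding S_def by linarith
    thus "infinite {l :: real. \<exists>A B C.
            hyp_triangle A B C \<and>
            hdist B C = 2 * ln (real_of_rat u) \<and>
            hdist C A = ln (real_of_rat w) \<and>
            hdist A B = l \<and>
            rational_length (hdist B C) \<and> rational_length (hdist C A) \<and>
            rational_length (hdist A B) \<and>
            (\<exists>M. hmidpoint B C M \<and> rational_length (hdist A M))}"
      using infinite_third_sides[OF u w] f by blast
  qed (rule c)
qed

end
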